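(* Let $\kappa,\lambda\in(0,1)$ with $\kappa^2+\lambda^2=1$, and let $\theta\in(0,\pi/6)$ be the angle with $\lambda=\cos 3\theta$ (equivalently $\kappa=\sin 3\theta$). Let $M>0$ be defined by $M^2=2\sqrt3\,\cos^2(\theta+\pi/6)\cos(2\theta-\pi/6)$. The fundamental period $2\,\mathrm{i}K'$ of $\mathrm{dn}_3$ is given by $$2K'=\frac{3\pi}{2M}\,F(\tfrac12,\tfrac12;1;k'^{\,2})$$ where $$k'^{\,2}=\frac{\cos^2(\theta-\pi/6)\cos(2\theta+\pi/6)}{\cos^2(\theta+\pi/6)\cos(2\theta-\pi/6)}.$$
   Context: $F(a,b;c;z)$ is the Gauss hypergeometric function ${}_2F_1$. Let $\phi$ be the analytic local inverse near $0$, with $\phi(0)=0$, of $f(T)=\int_0^T F(\tfrac13,\tfrac23;\tfrac12;\kappa^2\sin^2 t)\,dt$. The function $\mathrm{dn}_3$ is defined near $0$ by $\mathrm{dn}_3=\phi'$; it extends (uniquely) to an elliptic function on $\mathbb{C}$, also denoted $\mathrm{dn}_3$, namely $$\mathrm{dn}_3=1-\frac{\frac49\kappa^2}{\frac13+\wp},$$ where $\wp$ is the Weierstrass function (satisfying $(\wp')^2=4\wp^3-g_2\wp-g_3$, with a double pole at $0$) with invariants $g_2=\frac{4}{27}(1+8\lambda^2)$ and $g_3=\frac{8}{729}(8\lambda^4+20\lambda^2-1)$. The invariants are real and $g_2^3-27g_3^2>0$, so the period lattice of $\wp$ (which is also that of $\mathrm{dn}_3$) is rectangular: it is $\{2mK+2n\,\mathrm{i}K'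 : m,n\in\mathbb{Z}\}$ with $K>0$ and $K'>0$, which defines $K$ and $K'$. The constant $M$ arises as $M=\tfrac12\sqrt{(1+x_2)(x_3+x_1)}$, where $x_1\in(0,1)$, $-x_2\in(-2,0)$, $-x_3\in(-3,-2)$ are the three zeros of $x^3+3x^2-4\lambda^2$; this equals the expression in terms of $\theta$ used in the claim. *)

theory Defs
  imports "HOL-Complex_Analysis.Complex_Analysis"
begin

definition hyp2F1 :: "'a \<Rightarrow> 'a \<Rightarrow> 'a \<Rightarrow> 'a \<Rightarrow> 'a :: {banach, real_normed_field}" where
  "hyp2F1 a b c z = eval_fps (fps_hypergeo [a, b] [c] 1) z"

text \<open>
  Only the germ of this function at 0 matters: the hypergeometric series converges
  along the segment from 0 to \<open>T\<close> when \<open>T\<close> is small.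
\<close>
definition dn3_int :: "real \<Rightarrow> complex \<Rightarrow> complex" where
  "dn3_int \<kappa> T =
     contour_integral (linepath 0 T)
       (\<lambda>t. hyp2F1 (1/3) (2/3) (1/2) ((of_real \<kappa>)\<^sup>2 * (sin t)\<^sup>2))"

definition local_inverse_at_0 :: "(complex \<Rightarrow> complex) \<Rightarrow> (complex \<Rightarrow> complex) \<Rightarrow> bool" where
  "local_inverse_at_0 f \<phi> \<longleftrightarrow>
     \<phi> analytic_on {0} \<and> \<phi> 0 = 0 \<and>
     (\<forall>\<^sub>F z in nhds 0. f (\<phi> z) = z) \<and> (\<forall>\<^sub>F T in nhds 0. \<phi> (f T) = T)"

definition period_set :: "(complex \<Rightarrow> complex) \<Rightarrow> complex set" where
  "period_set g = {w. \<forall>z. g (z + w) = g z}"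

text \<open>
  The predicate \<open>nicely_meromorphic_on\<close> (removable singularities removed, value 0 at poles)
  makes the total function \<open>g\<close> canonical, so that its periods as a meromorphic
  function are exactly its pointwise periods.
\<close>
definition elliptic_function :: "(complex \<Rightarrow> complex) \<Rightarrow> bool" where
  "elliptic_function g \<longleftrightarrow>
     g nicely_meromorphic_on UNIV \<and>
     (\<exists>w1\<in>period_set g. \<exists>w2\<in>period_set g. w1 \<noteq> 0 \<and> Im (w2 / w1) \<noteq> 0)"

text \<open>
  By the identity theorem at most one function \<open>g\<close> satisfies \<open>is_dn3 \<kappa> g\<close>.
\<close>
definition is_dn3 :: "real \<Rightarrow> (complex \<Rightarrow> complex) \<Rightarrow> bool" where
  "is_dn3 \<kappa> g \<longleftrightarrow>
     elliptic_function g \<and>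
     (\<exists>\<phi>. local_inverse_at_0 (dn3_int \<kappa>) \<phi> \<and> (\<forall>\<^sub>F z in nhds 0. g z = deriv \<phi> z))"

definition rect_lattice :: "real \<Rightarrow> real \<Rightarrow> complex set" where
  "rect_lattice K K' =
     {2 * of_int m * of_real K + 2 * of_int n * (\<i> * of_real K') | m n. True}"

end

theory Submission
  imports Defs
begin

text \<open>
  The closed form \<open>F(1/3, 2/3; 1/2; sin\<^sup>2 u) = cos (u/3) / cos u\<close> shows that, near \<open>0\<close>,
  \<open>dn3 = 1 - 4 s\<^sup>2\<close> where \<open>sin u = \<kappa> sin \<phi>\<close> and \<open>s = sin (u/3)\<close>, and that
  \<open>9 s'\<^sup>2 = \<kappa>\<^sup>2 - (3 s - 4 s\<^sup>3)\<^sup>2 = \<kappa>\<^sup>2 (1 - p s\<^sup>2) (1 - q s\<^sup>2) (1 - r s\<^sup>2)\<close>. Here \<open>1/p\<close>, \<open>1/q\<close>, \<open>1/r\<close>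
  are the squared sines of \<open>\<theta>\<close>, \<open>\<pi>/3 - \<theta>\<close>, \<open>\<pi>/3 + \<theta>\<close>, because \<open>\<kappa> = sin 3\<theta>\<close>.
  The substitution \<open>sin\<^sup>2 w = (r - p) s\<^sup>2 / (1 - p s\<^sup>2)\<close> turns this into Legendre's form: the
  elliptic integral \<open>E w = \<integral> dw / sqrt (1 - k'\<^sup>2 sin\<^sup>2 w)\<close> equals \<open>\<mu> z\<close> with \<open>\<mu> = \<plusminus>2\<i>M/3\<close>.

  So \<open>dn3 (E w / \<mu>)\<close> is a Moebius function of \<open>sin\<^sup>2 w\<close> near \<open>0\<close>, hence, by the identity theorem,
  on a strip around the real axis; there \<open>E\<close> is holomorphic and injective, so no inverse of the
  elliptic integral is needed. Since \<open>E (w + \<pi>) = E w + E \<pi>\<close>, the number \<open>E \<pi> / \<mu>\<close> is a period.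
  Conversely, if \<open>E x / \<mu>\<close> is a period for a real \<open>x\<close>, then \<open>sin\<^sup>2 x = sin\<^sup>2 0 = 0\<close>.
  Therefore \<open>2 K' = 3 E \<pi> / (2 M)\<close>, and \<open>E \<pi> = \<pi> F(1/2, 1/2; 1; k'\<^sup>2)\<close> by termwise integration.
\<close>

subsection \<open>Two hypergeometric series\<close>

lemma fps_conv_radius_ge_1:
  fixes f :: "'a :: {banach, real_normed_field} fps"
  assumes "\<And>n. norm (fps_nth f n) \<le> 1"
  shows "fps_conv_radius f \<ge> 1"
  unfolding fps_conv_radius_def
proof (rule conv_radius_geI_ex')
  fix r :: real assume r: "0 < r" "ereal r < 1"
  show "summable (\<lambda>n. fps_nth f n * of_real r ^ n)"
  proof (rule summable_comparison_test')
    show "summable (\<lambda>n. r ^ n)" using r by (simp add: summable_geometric)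
    show "norm (fps_nth f n * of_real r ^ n) \<le> r ^ n" if "n \<ge> 0" for n
      using assms[of n] r by (simp add: norm_mult norm_power mult_left_le_one_le)
  qed
qed

lemma hypergeo_Suc:
  fixes a b c :: "'a :: field_char_0"
  shows "fps_nth (fps_hypergeo [a, b] [c] 1) (Suc n) =
    (a + of_nat n) * (b + of_nat n) / ((of_nat n + 1) * (c + of_nat n)) * fps_nth (fps_hypergeo [a, b] [c] 1) n"
  by (simp only: fps_hypergeo_rec) (simp add: algebra_simps)

section \<open>The series F(1/3, 2/3; 1/2; z)\<close>

text \<open>The ratio of consecutive coefficients is (n^2 + n + 2/9) / (n^2 + 3n/2 + 1/2), which
  lies in [0, 1]; so no coefficient exceeds 1 in norm.\<close>

lemma hypergeo_third_conv_radius: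
  "fps_conv_radius (fps_hypergeo [1/3, 2/3] [1/2] (1::complex)) > 0"
proof -
  have "norm (fps_nth (fps_hypergeo [1/3, 2/3] [1/2] (1::complex)) n) \<le> 1" for n
  proof (induction n)
    case (Suc n)
    let ?q = "(1/3 + real n) * (2/3 + real n) / ((real n + 1) * (1/2 + real n))"
    have eq: "(1/3 + of_nat n) * (2/3 + of_nat n) / ((of_nat n + 1) * (1/2 + of_nat n)) = complex_of_real ?q"
      by simp
    have "(real n + 1) * (1/2 + real n) > 0"
      by simp
    hence "0 \<le> ?q" "?q \<le> 1"
      by (simp_all only: divide_le_eq_1_pos) (simp_all add: algebra_simps)
    hence "norm (complex_of_real ?q) \<le> 1"
      by (simp only: norm_of_real)
    thus ?case
      unfolding hypergeo_Suc norm_mult eq using Suc by (intro mult_le_one norm_ge_zero)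
  qed (simp del: fps_hypergeo_nth)
  from fps_conv_radius_ge_1[OF this] show ?thesis
    by (rule less_le_trans[rotated]) simp
qed

text \<open>This is the hypergeometric equation z(1 - z)F'' + (c - (a + b + 1)z)F' - abF = 0 for a =
  1/3, b = 2/3, c = 1/2. Coefficientwise it is the two-term recurrence of the series.\<close>

lemma hypergeo_third_ode:
  defines "F \<equiv> fps_hypergeo [1/3, 2/3] [1/2] (1::complex)"
  shows "fps_X * fps_deriv (fps_deriv F) - fps_X ^ 2 * fps_deriv (fps_deriv F)
     + fps_const (1/2) * fps_deriv F - fps_const 2 * fps_X * fps_deriv F - fps_const (2/9) * F = 0"
    (is "?L = 0")
proof (rule fps_ext)
  fix n
  have *: "(of_nat n + 1) * (1/2 + of_nat n) * fps_nth F (Suc n) = (1/3 + of_nat n) * (2/3 + of_nat n) * fps_nth F n"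
  proof -
    have "complex_of_real ((real n + 1) * (1/2 + real n)) \<noteq> 0"
      unfolding of_real_eq_0_iff by (simp add: add_eq_0_iff)
    hence "(of_nat n + 1) * (1/2 + of_nat n :: complex) \<noteq> 0"
      by simp
    thus ?thesis
      unfolding F_def hypergeo_Suc by (simp del: fps_hypergeo_nth mult_eq_0_iff)
  qed
  have "fps_nth ?L n = of_nat n * of_nat (Suc n) * fps_nth F (Suc n) - of_nat n * (of_nat n - 1) * fps_nth F n
     + 1/2 * of_nat (Suc n) * fps_nth F (Suc n) - 2 * of_nat n * fps_nth F n - 2/9 * fps_nth F n"
    by (cases n; cases "n - 1")
       (auto simp: fps_X_power_mult_nth mult.assoc ring_distribs)
  also have "\<dots> = (of_nat n + 1) * (1/2 + of_nat n) * fps_nth F (Suc n)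
       - (1/3 + of_nat n) * (2/3 + of_nat n) * fps_nth F n"
    by (simp add: field_simps)
  finally show "fps_nth ?L n = fps_nth 0 n" using * by simp
qed

text \<open>
  The function \<open>p u = cos u * F (sin\<^sup>2 u)\<close> satisfies \<open>p'' = - p / 9\<close>, and
  \<open>A\<close>, \<open>B\<close> below are its constant coefficients with respect to \<open>cos (u/3)\<close> and \<open>sin (u/3)\<close>.
\<close>
lemma hyp2F1_third_sin:
  "\<forall>\<^sub>F u in nhds (0::complex). hyp2F1 (1/3) (2/3) (1/2) ((sin u)\<^sup>2) * cos u = cos (u / 3)"
proof -
  define F where "F = fps_hypergeo [1/3, 2/3] [1/2] (1::complex)"
  define F0 where "F0 = eval_fps F"
  define F1 where "F1 = eval_fps (fps_deriv F)"
  define F2 where "F2 = eval_fps (fps_deriv (fps_deriv F))"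
  have r: "fps_conv_radius F > 0" unfolding F_def by (rule hypergeo_third_conv_radius)
  have r1: "fps_conv_radius (fps_deriv F) > 0"
    using r fps_conv_radius_deriv[of F] by simp
  have r2: "fps_conv_radius (fps_deriv (fps_deriv F)) > 0"
    using r1 fps_conv_radius_deriv[of "fps_deriv F"] by simp
  have d0: "\<forall>\<^sub>F z in nhds 0. (F0 has_field_derivative F1 z) (at z)"
    unfolding F0_def F1_def using eventually_nhds_in_open[of "eball 0 (fps_conv_radius F)" 0] r
    by (auto elim!: eventually_mono intro!: has_field_derivative_eval_fps simp: zero_ereal_def)
  have d1: "\<forall>\<^sub>F z in nhds 0. (F1 has_field_derivative F2 z) (at z)"
    unfolding F1_def F2_def using eventually_nhds_in_open[of "eball 0 (fps_conv_radius (fps_deriv F))" 0] r1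
    by (auto elim!: eventually_mono intro!: has_field_derivative_eval_fps simp: zero_ereal_def)
  have ode: "\<forall>\<^sub>F z in nhds 0. z * F2 z - z^2 * F2 z + 1/2 * F1 z - 2 * z * F1 z - 2/9 * F0 z = 0"
  proof -
    have "F0 has_fps_expansion F" "F1 has_fps_expansion fps_deriv F"
      "F2 has_fps_expansion fps_deriv (fps_deriv F)"
      unfolding F0_def F1_def F2_def using r r1 r2 by (auto intro!: eval_fps_has_fps_expansion)
    hence "(\<lambda>z. z * F2 z - z^2 * F2 z + 1/2 * F1 z - 2 * z * F1 z - 2/9 * F0 z) has_fps_expansion
       fps_X * fps_deriv (fps_deriv F) - fps_X ^ 2 * fps_deriv (fps_deriv F)
     + fps_const (1/2) * fps_deriv F - fps_const 2 * fps_X * fps_deriv F - fps_const (2/9) * F"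
      by (intro fps_expansion_intros)
    thus ?thesis using hypergeo_third_ode by (simp add: F_def has_fps_expansion_0_iff)
  qed
  have "filterlim (\<lambda>u::complex. (sin u)\<^sup>2) (nhds 0) (nhds 0)"
    by (rule tendsto_eq_intros tendsto_ident_at filterlim_ident refl tendsto_sin | simp)+
  from eventually_compose_filterlim[OF eventually_conj[OF d0 eventually_conj[OF d1 ode]] this]
  have "\<exists>e>0. \<forall>u. dist u 0 < e \<longrightarrow>
     (F0 has_field_derivative F1 ((sin u)\<^sup>2)) (at ((sin u)\<^sup>2)) \<and>
     (F1 has_field_derivative F2 ((sin u)\<^sup>2)) (at ((sin u)\<^sup>2)) \<and>
     (let z = (sin u)^2 in z * F2 z - z^2 * F2 z + 1/2 * F1 z - 2 * z * F1 z - 2/9 * F0 z = 0)"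
    unfolding eventually_nhds_metric Let_def .
  then obtain e where "e > 0" and e: "\<And>u. u \<in> ball 0 e \<Longrightarrow>
     (F0 has_field_derivative F1 ((sin u)\<^sup>2)) (at ((sin u)\<^sup>2)) \<and>
     (F1 has_field_derivative F2 ((sin u)\<^sup>2)) (at ((sin u)\<^sup>2)) \<and>
     (let z = (sin u)^2 in z * F2 z - z^2 * F2 z + 1/2 * F1 z - 2 * z * F1 z - 2/9 * F0 z = 0)"
    by (metis dist_commute mem_ball)
  define p where "p = (\<lambda>u::complex. cos u * F0 ((sin u)\<^sup>2))"
  define q where "q = (\<lambda>u::complex. - sin u * F0 ((sin u)\<^sup>2) + 2 * sin u * (cos u)^2 * F1 ((sin u)\<^sup>2))"
  have F0': "((\<lambda>u. F0 ((sin u)\<^sup>2)) has_field_derivative F1 ((sin u)\<^sup>2) * (2 * sin u * cos u)) (at u)"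
    and F1': "((\<lambda>u. F1 ((sin u)\<^sup>2)) has_field_derivative F2 ((sin u)\<^sup>2) * (2 * sin u * cos u)) (at u)"
    if "u \<in> ball 0 e" for u
  proof -
    have *: "((\<lambda>u. (sin u)\<^sup>2) has_field_derivative 2 * sin u * cos u) (at u)"
      by (auto intro!: derivative_eq_intros)
    from e[OF that] show "((\<lambda>u. F0 ((sin u)\<^sup>2)) has_field_derivative F1 ((sin u)\<^sup>2) * (2 * sin u * cos u)) (at u)"
      and "((\<lambda>u. F1 ((sin u)\<^sup>2)) has_field_derivative F2 ((sin u)\<^sup>2) * (2 * sin u * cos u)) (at u)"
      by (blast intro: DERIV_chain2[OF _ *])+
  qed
  have dp: "(p has_field_derivative q u) (at u)" if "u \<in> ball 0 e" for u
  proof -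
    show ?thesis unfolding p_def q_def
      by (rule F0' that derivative_eq_intros refl)+ (simp add: power2_eq_square algebra_simps)
  qed
  have dq: "(q has_field_derivative - p u / 9) (at u)" if "u \<in> ball 0 e" for u
  proof -
    define x y where "x = sin u" and "y = cos u"
    have xy: "x^2 + y^2 = 1" by (simp add: x_def y_def)
    have o: "let z = x^2 in z * F2 z - z^2 * F2 z + 1/2 * F1 z - 2 * z * F1 z - 2/9 * F0 z = 0"
      using e[OF that] by (simp add: x_def)
    have 1: "(q has_field_derivative
       - y * F0 (x^2) - 2 * x^2 * y * F1 (x^2) + 2 * y^3 * F1 (x^2) - 4 * x^2 * y * F1 (x^2)
         + 4 * x^2 * y^3 * F2 (x^2)) (at u)"
      unfolding q_def x_def y_def
      by (rule F0' F1' that derivative_eq_intros refl)+ (simp add: power2_eq_square power3_eq_cube algebra_simps)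
    \<comment> \<open>The two sides differ by 4 cos u times the left side of the hypergeometric
      equation at z = (sin u)^2.\<close>
    have 2: "- y * F0 (x^2) - 2 * x^2 * y * F1 (x^2) + 2 * y^3 * F1 (x^2) - 4 * x^2 * y * F1 (x^2)
         + 4 * x^2 * y^3 * F2 (x^2) = - p u / 9"
      using xy o unfolding p_def x_def[symmetric] y_def[symmetric] Let_def by algebra
    from 1 show ?thesis unfolding 2 .
  qed
  define A where "A = (\<lambda>u. p u * cos (u/3) - 3 * q u * sin (u/3))"
  define B where "B = (\<lambda>u. p u * sin (u/3) + 3 * q u * cos (u/3))"
  have e0: "0 \<in> ball 0 e" using \<open>e > 0\<close> by simp
  have "hyp2F1 (1/3) (2/3) (1/2) ((sin u)\<^sup>2) * cos u = cos (u / 3)" if u: "u \<in> ball 0 e" for u :: complex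
  proof -
    have "(A has_field_derivative 0) (at x within ball 0 e)" "(B has_field_derivative 0) (at x within ball 0 e)"
      if "x \<in> ball 0 e" for x
      unfolding A_def B_def
      by (rule derivative_eq_intros dp[THEN has_field_derivative_at_within] dq[THEN has_field_derivative_at_within] that refl
          | simp add: algebra_simps)+
    from this(1)[THEN has_field_derivative_zero_constant[OF convex_ball]]
      this(2)[THEN has_field_derivative_zero_constant[OF convex_ball]]
    have "A u = A 0" "B u = B 0"
      using u e0 by auto
    moreover have "F0 0 = 1"
      by (simp add: F0_def F_def eval_fps_at_0)
    ultimately have "p u * cos (u/3) - 3 * q u * sin (u/3) = 1" "p u * sin (u/3) + 3 * q u * cos (u/3) = 0"
      by (simp_all add: A_def B_def p_def q_def)
    \<comment> \<open>Rotating the pair (\<open>A\<close>, \<open>B\<close>) = (1, 0) back by the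
      angle u/3 recovers \<open>p u\<close>.\<close>
    moreover have "p u * ((sin (u/3))\<^sup>2 + (cos (u/3))\<^sup>2) =
        cos (u/3) * (p u * cos (u/3) - 3 * q u * sin (u/3)) + sin (u/3) * (p u * sin (u/3) + 3 * q u * cos (u/3))"
      by algebra
    ultimately have "p u = cos (u/3)" by simp
    thus ?thesis by (simp add: p_def hyp2F1_def F0_def F_def mult.commute)
  qed
  thus ?thesis using \<open>e > 0\<close>
    by (intro eventually_mono[OF eventually_nhds_in_open[OF open_ball e0]])
qed

section \<open>The series F(1/2, 1/2; 1; m) as a complete elliptic integral\<close>

text \<open>Wallis's recursion (2n + 2) I(n + 1) = (2n + 1) I(n) comes from integrating the
  derivative of - cos x sin^(2n+1) x, a function that vanishes at both endpoints.\<close>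

lemma has_integral_sin_power_even:
  "((\<lambda>x. sin x ^ (2 * n)) has_integral pi * (pochhammer (1/2) n / fact n)) {0..pi}"
proof (induction n)
  case 0
  show ?case using has_integral_const_real[of "1::real" 0 pi] by simp
next
  case (Suc n)
  have "((\<lambda>x. (2 * n + 2) * sin x ^ (2 * Suc n) - (2 * n + 1) * sin x ^ (2 * n)) has_integral
      (- cos pi * sin pi ^ (2 * n + 1)) - (- cos 0 * sin 0 ^ (2 * n + 1))) {0..pi}"
  proof (rule fundamental_theorem_of_calculus)
    fix x :: real
    have "((\<lambda>x. - cos x * sin x ^ (2 * n + 1)) has_real_derivative
            (2 * n + 2) * sin x ^ (2 * Suc n) - (2 * n + 1) * sin x ^ (2 * n)) (at x within {0..pi})"
      (is "(_ has_real_derivative ?D) _")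
    proof -
      have "?D = sin x * sin x ^ (2 * n + 1) - cos x * ((2 * n + 1) * sin x ^ (2 * n) * cos x)"
      proof -
        have "cos x * ((2 * n + 1) * sin x ^ (2 * n) * cos x) = (2 * n + 1) * sin x ^ (2 * n) * (1 - (sin x)\<^sup>2)"
          by (simp only: cos_squared_eq[symmetric]) (simp add: power2_eq_square)
        thus ?thesis by (simp add: algebra_simps power2_eq_square)
      qed
      moreover have "((\<lambda>x. - cos x * sin x ^ (2 * n + 1)) has_real_derivative
          sin x * sin x ^ (2 * n + 1) - cos x * ((2 * n + 1) * sin x ^ (2 * n) * cos x)) (at x within {0..pi})"
        by (rule derivative_eq_intros refl)+ (simp add: algebra_simps)
      ultimately show ?thesis by (simp only:)
    qed
    thus "((\<lambda>x. - cos x * sin x ^ (2 * n + 1)) has_vector_derivative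
            (2 * n + 2) * sin x ^ (2 * Suc n) - (2 * n + 1) * sin x ^ (2 * n)) (at x within {0..pi})"
      by (rule has_real_derivative_iff_has_vector_derivative[THEN iffD1])
  qed auto
  hence "((\<lambda>x. (2 * n + 2) * sin x ^ (2 * Suc n) - (2 * n + 1) * sin x ^ (2 * n)) has_integral 0) {0..pi}"
    by simp
  from has_integral_add[OF this has_integral_mult_right[OF Suc, of "2 * n + 1"]]
  have "((\<lambda>x. (2 * n + 2) * sin x ^ (2 * Suc n)) has_integral
           (2 * n + 1) * (pi * (pochhammer (1/2) n / fact n))) {0..pi}"
    by simp
  from has_integral_mult_right[OF this, of "1 / (2 * n + 2)"]
  have *: "((\<lambda>x. sin x ^ (2 * Suc n)) has_integral
           1 / (2 * n + 2) * ((2 * n + 1) * (pi * (pochhammer (1/2) n / fact n)))) {0..pi}"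
    by (simp only: mult.assoc[symmetric]) (simp add: add.commute[of 2])
  have "1 / (2 * n + 2) * ((2 * n + 1) * (pi * (pochhammer (1/2) n / fact n))) =
      pi * (pochhammer (1/2) (Suc n) / fact (Suc n))"
    by (simp add: pochhammer_Suc field_simps)
  with * show ?case by (simp only:)
qed

text \<open>Binomial series for the exponent -1/2; the sign of the binomial coefficient cancels that
  of (-v)^n.\<close>

lemma inverse_sqrt_sums:
  fixes v :: real
  assumes "\<bar>v\<bar> < 1"
  shows "(\<lambda>n. pochhammer (1/2) n / fact n * v ^ n) sums (1 / sqrt (1 - v))"
proof -
  have "(\<lambda>n. ((-1/2) gchoose n) * (- v) ^ n) sums (1 + - v) powr (-1/2)"
    by (rule gen_binomial_real) (use assms in auto)
  moreover have "((-1/2) gchoose n) * (- v) ^ n = pochhammer (1/2) n / fact n * v ^ n" for n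
  proof -
    have "(-1) ^ n * (- v) ^ n = v ^ n"
      by (simp flip: power_mult_distrib)
    thus ?thesis by (simp add: gbinomial_pochhammer)
  qed
  moreover have "(1 + - v) powr (-1/2) = 1 / sqrt (1 - v)"
    using assms powr_minus_divide[of "1 - v" "1/2"] by (simp add: powr_half_sqrt)
  ultimately show ?thesis by simp
qed

lemma pochhammer_half_le_fact: "pochhammer (1/2 :: real) n \<le> fact n"
proof (induction n)
  case (Suc n)
  have "pochhammer (1/2 :: real) n * (1/2 + real n) \<le> fact n * (real n + 1)"
    using Suc by (intro mult_mono) auto
  thus ?case by (simp add: pochhammer_Suc algebra_simps)
qed auto

text \<open>The integrand is expanded by the binomial series, which converges uniformly in x because
  its terms are dominated by m^n, and is integrated term by term with Wallis's formula. The interval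
  from 0 to pi carries twice the complete integral of the first kind, hence the factor pi instead of
  pi/2.\<close>

lemma complete_elliptic_has_integral:
  fixes m :: real
  assumes m: "0 \<le> m" "m < 1"
  shows "((\<lambda>x. 1 / sqrt (1 - m * (sin x)\<^sup>2)) has_integral pi * hyp2F1 (1/2) (1/2) 1 m) {0..pi}"
proof -
  define c where "c = (\<lambda>n. pochhammer (1/2 :: real) n / fact n)"
  have c: "0 \<le> c n" "c n \<le> 1" for n
    using pochhammer_half_le_fact[of n] by (auto simp: c_def intro!: divide_nonneg_pos pochhammer_nonneg)
  have unif: "uniform_limit {0..pi} (\<lambda>N x. \<Sum>n<N. c n * m ^ n * sin x ^ (2 * n))
     (\<lambda>x. \<Sum>n. c n * m ^ n * sin x ^ (2 * n)) sequentially"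
  proof (rule Weierstrass_m_test)
    show "summable (\<lambda>n. m ^ n)" using m by (simp add: summable_geometric)
    fix n x
    have "\<bar>sin x ^ (2 * n)\<bar> \<le> (1::real)"
      by (simp add: power_abs power_le_one)
    hence "\<bar>c n * m ^ n * sin x ^ (2 * n)\<bar> \<le> 1 * m ^ n * 1"
      unfolding abs_mult using c m by (intro mult_mono) auto
    thus "norm (c n * m ^ n * sin x ^ (2 * n)) \<le> m ^ n"
      by simp
  qed
  have lim: "(\<Sum>n. c n * m ^ n * sin x ^ (2 * n)) = 1 / sqrt (1 - m * (sin x)\<^sup>2)" for x
  proof -
    have "m * (sin x)\<^sup>2 \<le> m * 1"
      using m by (intro mult_left_mono) (auto simp: abs_square_le_1)
    hence "\<bar>m * (sin x)\<^sup>2\<bar> < 1" using m by (simp add: abs_mult)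
    from sums_unique[OF inverse_sqrt_sums[OF this]] show ?thesis
      by (simp add: c_def power_mult_distrib power_mult mult.assoc)
  qed
  obtain I J where I: "\<And>N. ((\<lambda>x. \<Sum>n<N. c n * m ^ n * sin x ^ (2 * n)) has_integral I N) {0..pi}"
    and J: "((\<lambda>x. 1 / sqrt (1 - m * (sin x)\<^sup>2)) has_integral J) {0..pi}" "I \<longlonglongrightarrow> J"
  proof -
    have "continuous_on {0..pi} (\<lambda>x. \<Sum>n<N. c n * m ^ n * sin x ^ (2 * n))" for N
      by (intro continuous_intros)
    from uniform_limit_integral[OF unif[unfolded lim] this sequentially_bot]
    show ?thesis using that by blast
  qed
  have "I = (\<lambda>N. \<Sum>n<N. pi * (c n * c n * m ^ n))"
  proof (rule ext, rule has_integral_unique[OF I])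
    fix N
    have "((\<lambda>x. \<Sum>n<N. c n * m ^ n * sin x ^ (2 * n)) has_integral
        (\<Sum>n<N. c n * m ^ n * (pi * c n))) {0..pi}"
      unfolding c_def by (intro has_integral_sum has_integral_mult_right has_integral_sin_power_even) auto
    thus "((\<lambda>x. \<Sum>n<N. c n * m ^ n * sin x ^ (2 * n)) has_integral
        (\<Sum>n<N. pi * (c n * c n * m ^ n))) {0..pi}"
      by (simp add: mult_ac)
  qed
  hence "(\<lambda>n. pi * (c n * c n * m ^ n)) sums J"
    using J(2) by (simp add: sums_def)
  moreover have "(\<lambda>n. c n * c n * m ^ n) sums hyp2F1 (1/2) (1/2) 1 m"
  proof -
    have "summable (\<lambda>n. c n * c n * m ^ n)"
    proof (rule summable_comparison_test')
      show "summable (\<lambda>n. m ^ n)" using m by (simp add: summable_geometric)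
      show "norm (c n * c n * m ^ n) \<le> m ^ n" if "n \<ge> 0" for n
        using c[of n] m by (simp add: abs_mult mult_left_le_one_le mult_le_one)
    qed
    \<comment> \<open>One factor \<open>c n\<close> stems from the binomial series, the other from
      Wallis's formula. The lower parameter 1 supplies the second n! in the denominator.\<close>
    moreover have "fps_nth (fps_hypergeo [1/2, 1/2] [1] (1::real)) n = c n * c n" for n
      by (simp add: c_def pochhammer_fact[symmetric])
    ultimately show ?thesis
      by (simp add: hyp2F1_def eval_fps_def summable_sums del: fps_hypergeo_nth)
  qed
  hence "(\<lambda>n. pi * (c n * c n * m ^ n)) sums (pi * hyp2F1 (1/2) (1/2) 1 m)"
    by (rule sums_mult)
  ultimately show ?thesis
    using J(1) sums_unique2 by blast
qed

subsection \<open>The elliptic integral on a strip\<close>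

text \<open>If f took equal values at a and b, then Re (f / (b - a)) would have equal values at the
  ends of the segment from a to b, although its derivative along the segment is Re f' > 0 (the
  Noshiro-Warschawski argument).\<close>

lemma inj_on_convex_Re_deriv_pos:
  assumes S: "convex S"
    and der: "\<And>z. z \<in> S \<Longrightarrow> (f has_field_derivative f' z) (at z)"
    and pos: "\<And>z. z \<in> S \<Longrightarrow> Re (f' z) > 0"
  shows "inj_on f S"
proof (rule inj_onI, rule ccontr)
  fix a b assume ab: "a \<in> S" "b \<in> S" "f a = f b" "a \<noteq> b"
  define h where "h = (\<lambda>t. Re (f (a + of_real t * (b - a)) / (b - a)))"
  have "\<exists>y. (h has_real_derivative y) (at t) \<and> 0 < y" if "0 \<le> t" "t \<le> 1" for t
  proof -
    have "a + of_real t * (b - a) = (1 - t) *\<^sub>R a + t *\<^sub>R b"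
      by (simp add: scaleR_conv_of_real algebra_simps)
    also have "\<dots> \<in> S"
      using S ab that by (intro convexD) auto
    finally have in_S: "a + of_real t * (b - a) \<in> S" .
    have "((\<lambda>t. a + of_real t * (b - a)) has_vector_derivative (b - a)) (at t)"
      by (auto intro!: derivative_eq_intros)
    from field_vector_diff_chain_at[OF this der[OF in_S]]
    have "((\<lambda>t. f (a + of_real t * (b - a))) has_vector_derivative (b - a) * f' (a + of_real t * (b - a))) (at t)"
      by (simp add: o_def)
    hence "((\<lambda>t. f (a + of_real t * (b - a)) / (b - a)) has_vector_derivative f' (a + of_real t * (b - a))) (at t)"
      using has_vector_derivative_divide[of _ "(b - a) * f' (a + of_real t * (b - a))" "at t" "b - a"] ab
      by simp
    hence "(h has_real_derivative Re (f' (a + of_real t * (b - a)))) (at t)"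
      unfolding h_def by (rule has_field_derivative_Re)
    thus ?thesis using pos[OF in_S] by blast
  qed
  from DERIV_pos_imp_increasing[OF zero_less_one this] have "h 0 < h 1" .
  thus False using ab by (simp add: h_def)
qed

lemma open_strip: "open {z. \<bar>Im z\<bar> < d}"
  and convex_strip: "convex {z. \<bar>Im z\<bar> < d}"
proof -
  have *: "{z. \<bar>Im z\<bar> < d} = {z. Im z < d} \<inter> {z. Im z > - d}"
    by auto
  show "open {z. \<bar>Im z\<bar> < d}" "convex {z. \<bar>Im z\<bar> < d}"
    unfolding * by (intro open_Int open_halfspace_Im_lt open_halfspace_Im_gt convex_Int
      convex_halfspace_Im_lt convex_halfspace_Im_gt)+
qed

text \<open>On this strip |sin z|^2 \<le> exp (2 |Im z|) < exp (1 - m), and m \<le> exp (m - 1); so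
  m |sin z|^2 < 1. This fixes the width of the strip used throughout.\<close>

lemma Re_one_minus_sin_squared_pos:
  fixes m :: real
  assumes m: "0 < m" "m < 1" and z: "\<bar>Im z\<bar> < (1 - m) / 2"
  shows "Re (1 - of_real m * (sin z)\<^sup>2) > 0"
proof -
  have "(norm (sin z))\<^sup>2 \<le> exp (2 * \<bar>Im z\<bar>)"
  proof -
    have "exp (2 * Im z) \<le> exp (2 * \<bar>Im z\<bar>)" "inverse (exp (2 * Im z)) \<le> exp (2 * \<bar>Im z\<bar>)"
      by (auto simp flip: exp_minus)
    moreover have "1 \<le> exp (2 * \<bar>Im z\<bar>)" by simp
    moreover have "cos (2 * Re z) \<ge> -1" by simp
    ultimately show ?thesis
      unfolding norm_sin_squared by argo
  qed
  also have "\<dots> < exp (1 - m)" using z by simp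
  finally have "m * (norm (sin z))\<^sup>2 < m * exp (1 - m)"
    using m by simp
  also have "\<dots> \<le> exp (m - 1) * exp (1 - m)"
    using exp_ge_add_one_self[of "m - 1"] by (intro mult_right_mono) auto
  also have "\<dots> = 1" by (simp flip: exp_add)
  finally have "norm (of_real m * (sin z)\<^sup>2) < 1"
    using m by (simp add: norm_mult norm_power)
  with complex_Re_le_cmod[of "of_real m * (sin z)\<^sup>2"] show ?thesis
    by simp
qed

text \<open>The radicand stays in the right half-plane, so the principal root is holomorphic on the
  strip and the integrand has positive real part. Hence a primitive exists and is injective. It is
  quasi-periodic because the integrand has period pi, and real on the real axis because the
  integrand is.\<close>

lemma elliptic_integral_exists:
  fixes m :: real
  assumes m: "0 < m" "m < 1"
  obtains E where
    "\<And>z. \<bar>Im z\<bar> < (1 - m) / 2 \<Longrightarrow> (E has_field_derivative 1 / csqrt (1 - of_real m * (sin z)\<^sup>2)) (at z)"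
    "E 0 = 0"
    "inj_on E {z. \<bar>Im z\<bar> < (1 - m) / 2}"
    "\<And>z. \<bar>Im z\<bar> < (1 - m) / 2 \<Longrightarrow> E (z + of_real pi) = E z + E (of_real pi)"
    "\<And>x. E (of_real x) = of_real (Re (E (of_real x)))"
    "\<And>x. ((\<lambda>x. Re (E (of_real x))) has_real_derivative 1 / sqrt (1 - m * (sin x)\<^sup>2)) (at x)"
proof -
  define S where "S = {z. \<bar>Im z\<bar> < (1 - m) / 2}"
  define D where "D = (\<lambda>z. 1 / csqrt (1 - of_real m * (sin z)\<^sup>2))"
  have opS: "open S" and cvS: "convex S"
    unfolding S_def by (rule open_strip convex_strip)+
  have pos: "Re (1 - of_real m * (sin z)\<^sup>2) > 0" if "z \<in> S" for z
    using Re_one_minus_sin_squared_pos[OF m, of z] that by (simp add: S_def)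
  have nonneg: "1 - of_real m * (sin z)\<^sup>2 \<notin> \<real>\<^sub>\<le>\<^sub>0" if "z \<in> S" for z
    using pos[OF that] by (auto simp: complex_nonpos_Reals_iff)
  have Dpos: "Re (D z) > 0" if "z \<in> S" for z
  proof -
    let ?w = "1 - of_real m * (sin z)\<^sup>2"
    have "Re (csqrt w) > 0" if "Re w > 0" for w
      using that by (simp add: add_nonneg_pos)
    from this[OF pos[OF that]] have "Re (csqrt ?w) > 0" .
    moreover have "Re (1 / w) > 0" if "Re w > 0" for w
      using that by (simp add: Re_divide add_pos_nonneg)
    ultimately show ?thesis unfolding D_def by blast
  qed
  have "D holomorphic_on S"
    unfolding D_def using nonneg by (intro holomorphic_intros) force+
  from holomorphic_convex_primitive'[OF cvS opS this] obtain E0 where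
    E0: "\<And>z. z \<in> S \<Longrightarrow> (E0 has_field_derivative D z) (at z)"
    using at_within_open[OF _ opS] by metis
  define E where "E = (\<lambda>z. E0 z - E0 0)"
  have E: "(E has_field_derivative D z) (at z)" if "z \<in> S" for z
    unfolding E_def using E0[OF that] by (auto intro!: derivative_eq_intros)
  have realS: "of_real x \<in> S" for x using m by (simp add: S_def)
  have Dreal: "D (of_real x) = of_real (1 / sqrt (1 - m * (sin x)\<^sup>2))" for x
  proof -
    have "1 - of_real m * (sin (complex_of_real x))\<^sup>2 = of_real (1 - m * (sin x)\<^sup>2)"
      by (simp add: sin_of_real)
    moreover from this have "1 - m * (sin x)\<^sup>2 > 0"
      using pos[OF realS, of x] by (metis Re_complex_of_real)
    ultimately show ?thesis unfolding D_def by (simp del: of_real_diff of_real_mult)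
  qed
  have Evec: "((\<lambda>x. E (of_real x)) has_vector_derivative of_real (1 / sqrt (1 - m * (sin x)\<^sup>2))) (at x)" for x
    using has_vector_derivative_real_field[OF E[OF realS]] unfolding Dreal .
  have Im0: "Im (E (of_real x)) = 0" for x
  proof -
    have "((\<lambda>x. Im (E (of_real x))) has_real_derivative 0) (at x)" for x
      using has_field_derivative_Im[OF Evec[of x]] by simp
    from DERIV_isconst_all[of "\<lambda>x. Im (E (of_real x))" x 0] this
    show ?thesis by (simp add: E_def)
  qed
  show ?thesis
  proof (rule that[of E])
    show "E 0 = 0" by (simp add: E_def)
    show "(E has_field_derivative 1 / csqrt (1 - of_real m * (sin z)\<^sup>2)) (at z)"
      if "\<bar>Im z\<bar> < (1 - m) / 2" for z
      using E[of z] that unfolding D_def S_def by simp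
    show "inj_on E {z. \<bar>Im z\<bar> < (1 - m) / 2}"
      using inj_on_convex_Re_deriv_pos[OF cvS E Dpos] by (simp add: S_def)
    show "E (of_real x) = of_real (Re (E (of_real x)))" for x
      using Im0[of x] by (simp add: complex_eq_iff)
    show "((\<lambda>x. Re (E (of_real x))) has_real_derivative 1 / sqrt (1 - m * (sin x)\<^sup>2)) (at x)" for x
      using has_field_derivative_Re[OF Evec[of x]] by simp
    show "E (z + of_real pi) = E z + E (of_real pi)" if "\<bar>Im z\<bar> < (1 - m) / 2" for z
    proof -
      have "((\<lambda>z. E (z + of_real pi) - E z) has_field_derivative 0) (at z within S)" if "z \<in> S" for z
      proof -
        have "z + of_real pi \<in> S" using that by (simp add: S_def)
        have "D (z + of_real pi) = D z"
          by (simp add: D_def sin_add sin_of_real cos_of_real)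
        with E[OF \<open>z + of_real pi \<in> S\<close>]
        have "((\<lambda>z. E (z + of_real pi)) has_field_derivative D z) (at z)"
          by (simp add: DERIV_shift)
        from DERIV_diff[OF this E[OF that]] show ?thesis
          by (auto intro: has_field_derivative_at_within)
      qed
      from has_field_derivative_zero_constant[OF cvS this] obtain c where
        "\<And>z. z \<in> S \<Longrightarrow> E (z + of_real pi) - E z = c" by blast
      from this[of z] this[of 0] that m show ?thesis
        by (simp add: S_def E_def algebra_simps)
    qed
  qed
qed

subsection \<open>The differential equation of dn3\<close>

lemma eventually_nhds_compose_analytic:
  assumes "eventually P (nhds (f a))" "f analytic_on {a}"
  shows "\<forall>\<^sub>F z in nhds a. P (f z)"
proof (rule eventually_compose_filterlim[OF assms(1)])
  show "filterlim f (nhds (f a)) (nhds a)"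
    using analytic_at_imp_isCont[OF assms(2)] by (simp add: tendsto_nhds_iff isCont_def)
qed

lemma analytic_at_eventually_nonzero:
  assumes "f analytic_on {a}" "f a \<noteq> 0"
  shows "\<forall>\<^sub>F z in nhds a. f z \<noteq> 0"
  by (rule eventually_nhds_compose_analytic[OF t1_space_nhds[OF assms(2)] assms(1)])

lemma eventually_analytic_at:
  assumes "f analytic_on {a}"
  shows "\<forall>\<^sub>F z in nhds a. f analytic_on {z}"
proof -
  obtain S where "open S" "a \<in> S" "f holomorphic_on S"
    using assms by (auto simp: analytic_at)
  thus ?thesis
    by (auto intro!: eventually_mono[OF eventually_nhds_in_open[of S a]] simp: analytic_at)
qed

lemma analytic_at_nhds_DERIV:
  assumes "f analytic_on {a}"
  shows "\<forall>\<^sub>F z in nhds a. (f has_field_derivative deriv f z) (at z)"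
  using eventually_analytic_at[OF assms] by eventually_elim (rule analytic_derivI)

lemma analytic_at_compose:
  assumes "f analytic_on {a}" "g analytic_on {f a}"
  shows "(\<lambda>z. g (f z)) analytic_on {a}"
  using analytic_on_compose[of f "{a}" g] assms by (simp add: o_def)

section \<open>The local inverse of the defining integral\<close>

text \<open>On a small disc the integrand is holomorphic and has a primitive H, so the integral
  along the segment from 0 to T is H(T) - H(0).\<close>

lemma dn3_int_has_field_derivative:
  "\<forall>\<^sub>F T in nhds 0. (dn3_int \<kappa> has_field_derivative
      hyp2F1 (1/3) (2/3) (1/2) ((of_real \<kappa>)\<^sup>2 * (sin T)\<^sup>2)) (at T)"
proof -
  define h where "h = (\<lambda>t::complex. hyp2F1 (1/3) (2/3) (1/2) ((of_real \<kappa>)\<^sup>2 * (sin t)\<^sup>2) :: complex)"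
  have "(\<lambda>t::complex. (of_real \<kappa>)\<^sup>2 * (sin t)\<^sup>2 :: complex) analytic_on {0}"
    by (intro analytic_intros)
  hence "h analytic_on {0}"
    unfolding h_def hyp2F1_def
    by (rule analytic_at_compose, intro analytic_on_eval_fps)
       (use hypergeo_third_conv_radius in \<open>auto simp: in_eball_iff zero_ereal_def\<close>)
  then obtain e where e: "e > 0" "h holomorphic_on ball 0 e"
    by (auto simp: analytic_on_def)
  from holomorphic_convex_primitive'[OF convex_ball open_ball e(2)] obtain H where
    H: "\<And>z. z \<in> ball 0 e \<Longrightarrow> (H has_field_derivative h z) (at z within ball 0 e)" by blast
  have eq: "dn3_int \<kappa> T = H T - H 0" if "T \<in> ball 0 e" for T
  proof -
    have "path_image (linepath 0 T) \<subseteq> ball 0 e"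
      unfolding path_image_linepath using that e(1) by (intro closed_segment_subset) auto
    from contour_integral_primitive[OF H _ this] show ?thesis
      unfolding dn3_int_def h_def[symmetric] by (auto intro!: contour_integral_unique)
  qed
  have "(dn3_int \<kappa> has_field_derivative h T) (at T)" if T: "T \<in> ball 0 e" for T
  proof -
    have "(H has_field_derivative h T) (at T)"
      using H[OF T] by (simp only: at_within_open[OF T open_ball])
    from DERIV_diff[OF this DERIV_const[of "H 0"]]
    have "((\<lambda>T. H T - H 0) has_field_derivative h T) (at T)" by simp
    thus ?thesis
      by (rule has_field_derivative_transform_within_open[OF _ open_ball T]) (simp add: eq)
  qed
  moreover have "\<forall>\<^sub>F T in nhds 0. T \<in> ball 0 e"
    using e(1) by (intro eventually_nhds_in_open) auto
  ultimately show ?thesis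
    unfolding h_def by (auto elim!: eventually_mono)
qed

lemma analytic_at_Arcsin_0: "Arcsin analytic_on {0}"
proof -
  have "Arcsin holomorphic_on ball 0 1"
    using abs_Re_le_cmod by (intro holomorphic_on_Arcsin) (auto intro: le_less_trans)
  thus ?thesis by (auto simp: analytic_at intro!: exI[of _ "ball 0 1"])
qed

lemma sin_treble_sin:
  fixes x :: "'a :: {real_normed_field, banach}"
  shows "sin (3 * x) = 3 * sin x - 4 * sin x ^ 3"
proof -
  have "sin (3 * x) = sin (2 * x + x)" by simp
  also have "\<dots> = 2 * sin x * (cos x)\<^sup>2 + (1 - 2 * (sin x)\<^sup>2) * sin x"
    unfolding sin_add sin_double cos_double_sin by (simp add: power2_eq_square)
  also have "\<dots> = 3 * sin x - 4 * sin x ^ 3"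
    unfolding cos_squared_eq by (simp add: algebra_simps power2_eq_square power3_eq_cube)
  finally show ?thesis .
qed

text \<open>Put sin u = \<kappa> sin \<phi> and s = sin (u/3). Differentiating
  \<open>dn3_int \<kappa> (\<phi> z) = z\<close> gives \<phi>' = cos u / cos (u/3), which is 4 cos^2
  (u/3) - 3 = 1 - 4 s^2 by the triple angle formula. Differentiating sin u = \<kappa> sin \<phi>
  then gives 3 s' = \<kappa> cos \<phi>, whose square is \<kappa>^2 - sin^2 u with sin u = 3 s - 4
  s^3.\<close>

lemma deriv_local_inverse_dn3_int:
  fixes \<kappa> :: real
  assumes \<phi>: "local_inverse_at_0 (dn3_int \<kappa>) \<phi>"
  obtains s where "s analytic_on {0}" "s 0 = 0"
    "\<forall>\<^sub>F z in nhds 0. deriv \<phi> z = 1 - 4 * (s z)\<^sup>2"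
    "\<forall>\<^sub>F z in nhds 0. 9 * (deriv s z)\<^sup>2 = (of_real \<kappa>)\<^sup>2 - (3 * s z - 4 * s z ^ 3)\<^sup>2"
proof -
  define k where "k = complex_of_real \<kappa>"
  define u where "u = (\<lambda>z. Arcsin (k * sin (\<phi> z)))"
  define s where "s = (\<lambda>z. sin (u z / 3))"
  have \<phi>_an: "\<phi> analytic_on {0}" and \<phi>0: "\<phi> 0 = 0"
    and inv: "\<forall>\<^sub>F z in nhds 0. dn3_int \<kappa> (\<phi> z) = z"
    using \<phi> by (auto simp: local_inverse_at_0_def)
  have u0: "u 0 = 0" by (simp add: u_def \<phi>0)
  have "(\<lambda>z. k * sin (\<phi> z)) analytic_on {0}"
    using \<phi>_an by (intro analytic_intros)
  hence u_an: "u analytic_on {0}"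
    unfolding u_def by (rule analytic_at_compose) (simp add: \<phi>0 analytic_at_Arcsin_0)
  have s_an: "s analytic_on {0}"
    unfolding s_def using u_an by (intro analytic_intros) auto
  have sin_u: "sin (u z) = k * sin (\<phi> z)" for z
    by (simp add: u_def)
  have hyp: "\<forall>\<^sub>F z in nhds 0. hyp2F1 (1/3) (2/3) (1/2) ((sin (u z))\<^sup>2) * cos (u z) = cos (u z / 3)"
    using hyp2F1_third_sin by (intro eventually_nhds_compose_analytic[OF _ u_an]) (simp add: u0)
  have der: "\<forall>\<^sub>F z in nhds 0. (dn3_int \<kappa> has_field_derivative
      hyp2F1 (1/3) (2/3) (1/2) (k\<^sup>2 * (sin (\<phi> z))\<^sup>2)) (at (\<phi> z))"
    unfolding k_def using dn3_int_has_field_derivative[of \<kappa>]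
    by (intro eventually_nhds_compose_analytic[OF _ \<phi>_an]) (simp add: \<phi>0)
  have "(\<lambda>z. cos (u z / 3)) analytic_on {0}"
    using u_an by (intro analytic_intros) auto
  hence "\<forall>\<^sub>F z in nhds 0. cos (u z / 3) \<noteq> 0"
    by (rule analytic_at_eventually_nonzero) (simp add: u0)
  \<comment> \<open>\<open>eventually_eventually\<close> provides the inverse relation on a whole
    neighbourhood of each z near 0, so that it may be differentiated at z.\<close>
  hence main: "\<forall>\<^sub>F z in nhds 0. deriv \<phi> z = 1 - 4 * (s z)\<^sup>2 \<and> 3 * deriv s z = k * cos (\<phi> z)"
    using hyp der eventually_eventually[THEN iffD2, OF inv] analytic_at_nhds_DERIV[OF \<phi>_an] analytic_at_nhds_DERIV[OF u_an]
  proof eventually_elim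
    case (elim z)
    define c where "c = cos (u z / 3)"
    define G where "G = hyp2F1 (1/3) (2/3) (1/2) ((sin (u z))\<^sup>2)"
    have G: "(dn3_int \<kappa> has_field_derivative G) (at (\<phi> z))"
      using elim(3) by (simp add: G_def sin_u power_mult_distrib)
    have "((\<lambda>z. dn3_int \<kappa> (\<phi> z)) has_field_derivative G * deriv \<phi> z) (at z)"
      by (rule DERIV_chain2[OF G elim(5)])
    moreover have "((\<lambda>z. dn3_int \<kappa> (\<phi> z)) has_field_derivative 1) (at z)"
      using elim(4) by (subst DERIV_cong_ev[OF refl _ refl]) auto
    ultimately have G1: "G * deriv \<phi> z = 1" by (rule DERIV_unique)
    hence "cos (u z) = (G * cos (u z)) * deriv \<phi> z"
      by (simp add: mult_ac)
    also have "G * cos (u z) = c"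
      using elim(2) by (simp add: G_def c_def)
    finally have cu: "cos (u z) = c * deriv \<phi> z" .
    have "((\<lambda>z. sin (u z)) has_field_derivative cos (u z) * deriv (u) z) (at z)"
      by (auto intro!: derivative_eq_intros elim(6)[THEN DERIV_cong])
    moreover have "((\<lambda>z. sin (u z)) has_field_derivative k * (cos (\<phi> z) * deriv \<phi> z)) (at z)"
      unfolding sin_u by (auto intro!: derivative_eq_intros elim(5)[THEN DERIV_cong])
    ultimately have "cos (u z) * deriv u z = k * (cos (\<phi> z) * deriv \<phi> z)" by (rule DERIV_unique)
    hence "c * deriv u z * deriv \<phi> z = k * cos (\<phi> z) * deriv \<phi> z"
      by (simp add: cu mult_ac)
    moreover have "deriv \<phi> z \<noteq> 0" using G1 by auto
    ultimately have cu': "c * deriv u z = k * cos (\<phi> z)" by simp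
    have "(s has_field_derivative c * (deriv u z / 3)) (at z)"
      unfolding s_def c_def by (auto intro!: derivative_eq_intros elim(6)[THEN DERIV_cong])
    hence "3 * deriv s z = k * cos (\<phi> z)"
      using cu' by (simp add: DERIV_imp_deriv)
    moreover have "cos (u z) = 4 * c ^ 3 - 3 * c"
      using cos_treble_cos[of "u z / 3"] by (simp add: c_def)
    hence "c * deriv \<phi> z = c * (4 * c\<^sup>2 - 3)"
      by (simp add: cu[symmetric] algebra_simps power2_eq_square power3_eq_cube)
    hence "deriv \<phi> z = 4 * c\<^sup>2 - 3"
      using elim(1) by (simp add: c_def)
    hence "deriv \<phi> z = 1 - 4 * (s z)\<^sup>2"
      by (simp add: c_def s_def cos_squared_eq)
    ultimately show ?case by blast
  qed
  show thesis
  proof (rule that[OF s_an])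
    show "s 0 = 0" by (simp add: s_def u0)
    show "\<forall>\<^sub>F z in nhds 0. deriv \<phi> z = 1 - 4 * (s z)\<^sup>2"
      using main by eventually_elim simp
    show "\<forall>\<^sub>F z in nhds 0. 9 * (deriv s z)\<^sup>2 = (of_real \<kappa>)\<^sup>2 - (3 * s z - 4 * s z ^ 3)\<^sup>2"
      using main
    proof eventually_elim
      case (elim z)
      have "sin (u z) = 3 * s z - 4 * s z ^ 3"
        using sin_treble_sin[of "u z / 3"] by (simp add: s_def)
      hence *: "k * sin (\<phi> z) = 3 * s z - 4 * s z ^ 3" by (simp add: sin_u)
      have "(of_real \<kappa>)\<^sup>2 - (3 * s z - 4 * s z ^ 3)\<^sup>2 = k\<^sup>2 * (1 - (sin (\<phi> z))\<^sup>2)"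
        unfolding *[symmetric] by (simp add: k_def power_mult_distrib algebra_simps)
      also have "\<dots> = (3 * deriv s z)\<^sup>2"
        using elim by (simp only: cos_squared_eq[symmetric] power_mult_distrib)
      finally show ?case
        by (simp add: power_mult_distrib)
    qed
  qed
qed

section \<open>Legendre's substitution\<close>

text \<open>Pointwise algebra of the substitution: \<open>sw\<close>, \<open>cw\<close> are sine and
  cosine of the new variable w, \<open>rt\<close> is a root of 1 - p s^2, the letters
  \<open>pd\<close>, \<open>rd\<close>, \<open>sd\<close> are the derivatives of w,
  \<open>rt\<close>, s, and \<open>W\<close> is the derivative of the elliptic integral. Up to the
  factor \<open>rt\<^sup>2\<close>, \<open>cw\<^sup>2\<close> becomes 1 - r s^2 and 1 - m
  \<open>sw\<^sup>2\<close> becomes 1 - q s^2, so all variable factors cancel.\<close>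

lemma elliptic_substitution_derivative:
  fixes b C D W cw sw rt rd s sd pd p q r m :: complex
  assumes "cw * pd * rt + sw * rd = b * sd" "rt * rd = - p * s * sd" "rt\<^sup>2 = 1 - p * s\<^sup>2"
    and "sw * rt = b * s" "b\<^sup>2 = r - p" "m * (p - r) = p - q"
    and "sd\<^sup>2 = C * (1 - p * s\<^sup>2) * (1 - q * s\<^sup>2) * (1 - r * s\<^sup>2)"
    and "cw\<^sup>2 = 1 - sw\<^sup>2" "W = D * pd" "D\<^sup>2 * (1 - m * sw\<^sup>2) = 1"
    and nz: "cw \<noteq> 0" "rt \<noteq> 0" "1 - m * sw\<^sup>2 \<noteq> 0"
  shows "W\<^sup>2 = (r - p) * C"
proof -
  \<comment> \<open>Multiplying by \<open>rt\<^sup>2\<close> eliminates \<open>rd\<close>; what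
    remains is b \<open>sd\<close> (\<open>rt\<^sup>2\<close> + p s^2) = b
    \<open>sd\<close>.\<close>
  have 1: "cw * pd * rt ^ 3 = b * sd"
  proof -
    have "cw * pd * rt ^ 3 = (b * sd - sw * rd) * rt\<^sup>2"
      by (simp add: assms(1)[symmetric] power2_eq_square power3_eq_cube)
    also have "\<dots> = b * sd * rt\<^sup>2 - (sw * rt) * (rt * rd)"
      by (simp add: algebra_simps power2_eq_square)
    also have "\<dots> = b * sd"
      unfolding assms(2-4) by (simp add: algebra_simps power2_eq_square)
    finally show ?thesis .
  qed
  have sw2: "sw\<^sup>2 * rt\<^sup>2 = (r - p) * s\<^sup>2"
    by (simp add: power_mult_distrib[symmetric] assms(4)) (simp add: power_mult_distrib assms(5))
  have cw2: "cw\<^sup>2 * rt\<^sup>2 = 1 - r * s\<^sup>2"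
    by (simp add: assms(8) left_diff_distrib sw2) (simp add: assms(3) algebra_simps)
  have mw2: "(1 - m * sw\<^sup>2) * rt\<^sup>2 = 1 - q * s\<^sup>2"
  proof -
    have "(1 - m * sw\<^sup>2) * rt\<^sup>2 = rt\<^sup>2 - m * (sw\<^sup>2 * rt\<^sup>2)"
      by (simp add: algebra_simps)
    also have "\<dots> = 1 - p * s\<^sup>2 + m * (p - r) * s\<^sup>2"
      by (simp only: sw2) (simp add: assms(3) algebra_simps)
    finally show ?thesis by (simp only: assms(6)) (simp add: algebra_simps)
  qed
  have "W\<^sup>2 * (cw\<^sup>2 * rt ^ 6 * (1 - m * sw\<^sup>2)) = (D\<^sup>2 * (1 - m * sw\<^sup>2)) * (cw * pd * rt ^ 3)\<^sup>2"
    by (simp add: assms(9) power_mult_distrib mult_ac flip: power_mult)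
  also have "\<dots> = (r - p) * sd\<^sup>2"
    by (simp add: 1 assms(10) power_mult_distrib assms(5))
  also have "\<dots> = (r - p) * C * (rt\<^sup>2 * ((1 - m * sw\<^sup>2) * rt\<^sup>2) * (cw\<^sup>2 * rt\<^sup>2))"
    unfolding cw2 mw2 unfolding assms(3,7) by (simp add: mult_ac)
  also have "\<dots> = (r - p) * C * (cw\<^sup>2 * rt ^ 6 * (1 - m * sw\<^sup>2))"
    by (simp add: mult_ac power_numeral_reduce)
  finally show ?thesis using nz by simp
qed

text \<open>With \<psi> the substituted variable as a function of z, the composition F = E \<circ>
  \<psi> has constant squared derivative, hence F z = \<mu> z near 0. At z = E w / \<mu> this reads
  E (\<psi> z) = E w, and injectivity of E gives \<psi> z = w. Thus the relation for sin \<psi>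
  becomes one for sin w without inverting E.\<close>

lemma elliptic_integral_linearises:
  fixes p q r m C :: complex and s E :: "complex \<Rightarrow> complex"
  assumes s: "s analytic_on {0}" "s 0 = 0"
    and ode: "\<forall>\<^sub>F z in nhds 0.
       (deriv s z)\<^sup>2 = C * (1 - p * (s z)\<^sup>2) * (1 - q * (s z)\<^sup>2) * (1 - r * (s z)\<^sup>2)"
    and m: "m * (p - r) = p - q" and nz: "C \<noteq> 0" "p \<noteq> r"
    and S: "open S" "0 \<in> S" and E0: "E 0 = 0" and inj: "inj_on E S"
    and E: "\<And>z. z \<in> S \<Longrightarrow> (E has_field_derivative 1 / csqrt (1 - m * (sin z)\<^sup>2)) (at z)"
  obtains \<mu> where "\<mu>\<^sup>2 = (r - p) * C"
    "\<forall>\<^sub>F w in nhds 0. (sin w)\<^sup>2 * (1 - p * (s (E w / \<mu>))\<^sup>2) = (r - p) * (s (E w / \<mu>))\<^sup>2"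
proof -
  define b where "b = csqrt (r - p)"
  have b: "b\<^sup>2 = r - p" by (simp add: b_def)
  define rt where "rt = (\<lambda>z. csqrt (1 - p * (s z)\<^sup>2))"
  define \<psi> where "\<psi> = (\<lambda>z. Arcsin (b * s z / rt z))"
  define F where "F = (\<lambda>z. E (\<psi> z))"
  have rt2: "(rt z)\<^sup>2 = 1 - p * (s z)\<^sup>2" for z by (simp add: rt_def)
  have rt0: "rt 0 = 1" and \<psi>0: "\<psi> 0 = 0" by (simp_all add: rt_def \<psi>_def s)
  have rt_an: "rt analytic_on {0}"
    unfolding rt_def using s(1) by (intro analytic_intros) (auto simp: s(2))
  have "(\<lambda>z. b * s z / rt z) analytic_on {0}"
    using s(1) rt_an by (intro analytic_intros) (auto simp: rt0)
  hence \<psi>_an: "\<psi> analytic_on {0}"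
    unfolding \<psi>_def by (rule analytic_at_compose) (simp add: s(2) analytic_at_Arcsin_0)
  have "E holomorphic_on S"
    using E S(1) by (auto simp: holomorphic_on_open)
  hence E_an: "E analytic_on {0}"
    using S by (auto simp: analytic_at)
  have F_an: "F analytic_on {0}"
    unfolding F_def by (rule analytic_at_compose[OF \<psi>_an]) (simp add: \<psi>0 E_an)
  have rt_nz: "\<forall>\<^sub>F z in nhds 0. rt z \<noteq> 0"
    by (rule analytic_at_eventually_nonzero[OF rt_an]) (simp add: rt0)
  have sin_\<psi>: "\<forall>\<^sub>F z in nhds 0. sin (\<psi> z) * rt z = b * s z"
    using rt_nz by eventually_elim (simp add: \<psi>_def)
  have "(\<lambda>z. cos (\<psi> z)) analytic_on {0}" "(\<lambda>z. 1 - m * (sin (\<psi> z))\<^sup>2) analytic_on {0}"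
    using \<psi>_an by (auto intro!: analytic_intros)
  hence cos_nz: "\<forall>\<^sub>F z in nhds 0. cos (\<psi> z) \<noteq> 0 \<and> 1 - m * (sin (\<psi> z))\<^sup>2 \<noteq> 0"
    by (intro eventually_conj analytic_at_eventually_nonzero) (auto simp: \<psi>0)
  have \<psi>_S: "\<forall>\<^sub>F z in nhds 0. \<psi> z \<in> S"
    by (rule eventually_nhds_compose_analytic[OF _ \<psi>_an]) (use S in \<open>auto simp: \<psi>0 intro!: eventually_nhds_in_open\<close>)
  have F_deriv: "\<forall>\<^sub>F z in nhds 0. (deriv F z)\<^sup>2 = (r - p) * C"
    using rt_nz cos_nz \<psi>_S ode sin_\<psi> eventually_eventually[THEN iffD2, OF sin_\<psi>]
      analytic_at_nhds_DERIV[OF s(1)] analytic_at_nhds_DERIV[OF rt_an] analytic_at_nhds_DERIV[OF \<psi>_an]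
  proof eventually_elim
    case (elim z)
    note sd = elim(7) and rd = elim(8) and pd = elim(9)
    have "((\<lambda>z. sin (\<psi> z) * rt z) has_field_derivative
        cos (\<psi> z) * deriv \<psi> z * rt z + sin (\<psi> z) * deriv rt z) (at z)"
      by (auto intro!: derivative_eq_intros rd[THEN DERIV_cong] pd[THEN DERIV_cong])
    moreover have "((\<lambda>z. sin (\<psi> z) * rt z) has_field_derivative b * deriv s z) (at z)"
      using DERIV_cong_ev[OF refl elim(6) refl] DERIV_cmult[OF sd] by blast
    ultimately have 1: "cos (\<psi> z) * deriv \<psi> z * rt z + sin (\<psi> z) * deriv rt z = b * deriv s z"
      by (rule DERIV_unique)
    have "((\<lambda>z. (rt z)\<^sup>2) has_field_derivative 2 * (rt z * deriv rt z)) (at z)"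
      by (auto intro!: derivative_eq_intros rd[THEN DERIV_cong])
    moreover have "((\<lambda>z. (rt z)\<^sup>2) has_field_derivative 2 * (- p * s z * deriv s z)) (at z)"
      unfolding rt2 by (auto intro!: derivative_eq_intros sd[THEN DERIV_cong])
    ultimately have "2 * (rt z * deriv rt z) = 2 * (- p * s z * deriv s z)"
      by (rule DERIV_unique)
    hence 2: "rt z * deriv rt z = - p * s z * deriv s z" by simp
    have 3: "deriv F z = 1 / csqrt (1 - m * (sin (\<psi> z))\<^sup>2) * deriv \<psi> z"
      unfolding F_def by (rule DERIV_imp_deriv, rule DERIV_chain2[OF E[OF elim(3)] pd])
    have 4: "(1 / csqrt (1 - m * (sin (\<psi> z))\<^sup>2))\<^sup>2 * (1 - m * (sin (\<psi> z))\<^sup>2) = 1"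
      using elim(2) by (simp add: power_divide)
    show ?case
      by (rule elliptic_substitution_derivative[OF 1 2 rt2 elim(5) b m elim(4) cos_squared_eq 3 4])
        (use elim(1,2) in auto)
  qed
  define \<mu> where "\<mu> = deriv F 0"
  have \<mu>2: "\<mu>\<^sup>2 = (r - p) * C"
    unfolding \<mu>_def using eventually_nhds_x_imp_x[OF F_deriv] .
  hence \<mu>_nz: "\<mu> \<noteq> 0" using nz by auto
  \<comment> \<open>The square leaves F' = \<mu> or F' = - \<mu>. Since F' + \<mu> equals 2\<mu> at
    0, it is nonzero nearby, which excludes the second sign.\<close>
  have "(\<lambda>z. deriv F z + \<mu>) analytic_on {0}"
    using F_an by (intro analytic_intros)
  hence "\<forall>\<^sub>F z in nhds 0. deriv F z + \<mu> \<noteq> 0"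
    by (rule analytic_at_eventually_nonzero) (use \<mu>_nz in \<open>simp add: \<mu>_def\<close>)
  hence "\<forall>\<^sub>F z in nhds 0. (F has_field_derivative \<mu>) (at z)"
    using F_deriv analytic_at_nhds_DERIV[OF F_an]
  proof eventually_elim
    case (elim z)
    have "deriv F z = \<mu>"
      using elim(1,2) \<mu>2 by (metis power2_eq_iff add.left_inverse)
    with elim(3) show ?case by simp
  qed
  then obtain e where "e > 0" and e: "\<And>z. dist z 0 < e \<Longrightarrow> (F has_field_derivative \<mu>) (at z)"
    unfolding eventually_nhds_metric by blast
  have lin: "F z = \<mu> * z" if "z \<in> ball 0 e" for z
  proof -
    have "((\<lambda>z. F z - \<mu> * z) has_field_derivative 0) (at z within ball 0 e)" if "z \<in> ball 0 e" for z
      using that by (auto intro!: derivative_eq_intros e[THEN DERIV_cong, THEN has_field_derivative_at_within] simp: dist_commute)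
    from has_field_derivative_zero_constant[OF convex_ball this] obtain c where
      "\<And>z. z \<in> ball 0 e \<Longrightarrow> F z - \<mu> * z = c" by blast
    from this[OF that] this[of 0] \<open>e > 0\<close> show ?thesis
      by (simp add: F_def \<psi>0 E0)
  qed
  have "\<forall>\<^sub>F z in nhds 0. z \<in> ball 0 e"
    using \<open>e > 0\<close> by (intro eventually_nhds_in_open) auto
  hence "\<forall>\<^sub>F z in nhds (E 0 / \<mu>). F z = \<mu> * z \<and> \<psi> z \<in> S \<and> (sin (\<psi> z))\<^sup>2 * (1 - p * (s z)\<^sup>2) = (r - p) * (s z)\<^sup>2"
    unfolding E0 div_0 using \<psi>_S sin_\<psi>
  proof eventually_elim
    case (elim z)
    have "(sin (\<psi> z))\<^sup>2 * (1 - p * (s z)\<^sup>2) = (sin (\<psi> z) * rt z)\<^sup>2"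
      by (simp add: rt2[symmetric] power_mult_distrib)
    also have "\<dots> = (r - p) * (s z)\<^sup>2"
      by (simp add: elim(3) power_mult_distrib b)
    finally show ?case using lin elim(1,2) by simp
  qed
  moreover have "(\<lambda>w. E w / \<mu>) analytic_on {0}"
    using E_an \<mu>_nz by (intro analytic_intros) auto
  note eventually_nhds_compose_analytic[where f = "\<lambda>w. E w / \<mu>", OF _ this]
  ultimately have "\<forall>\<^sub>F w in nhds 0. F (E w / \<mu>) = \<mu> * (E w / \<mu>) \<and> \<psi> (E w / \<mu>) \<in> S \<and>
    (sin (\<psi> (E w / \<mu>)))\<^sup>2 * (1 - p * (s (E w / \<mu>))\<^sup>2) = (r - p) * (s (E w / \<mu>))\<^sup>2"
    by blast
  moreover have "\<forall>\<^sub>F w in nhds 0. w \<in> S"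
    using S by (intro eventually_nhds_in_open)
  ultimately have "\<forall>\<^sub>F w in nhds 0. (sin w)\<^sup>2 * (1 - p * (s (E w / \<mu>))\<^sup>2) = (r - p) * (s (E w / \<mu>))\<^sup>2"
  proof eventually_elim
    case (elim w)
    have "E (\<psi> (E w / \<mu>)) = E w"
      using elim(1) \<mu>_nz by (simp add: F_def)
    hence "\<psi> (E w / \<mu>) = w"
      using inj elim by (auto dest: inj_onD)
    with elim(1) show ?case by simp
  qed
  with \<mu>2 show thesis by (rule that)
qed

subsection \<open>Periods\<close>

text \<open>By the identity theorem the equation holds on a punctured neighbourhood of every point,
  so g has the same limiting behaviour at z and z + \<omega>. The normalisation then forces equal
  values: both 0 at a pole, both the common limit otherwise.\<close>

lemma nicely_meromorphic_frequently_shift_imp_period: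
  assumes g: "g nicely_meromorphic_on UNIV" and freq: "\<exists>\<^sub>F z in at a. g (z + \<omega>) = g z"
  shows "\<omega> \<in> period_set g"
proof -
  have mero: "g meromorphic_on UNIV"
    using g by (simp add: nicely_meromorphic_on_def)
  have "(\<lambda>z. g (z + \<omega>) - g z) meromorphic_on UNIV"
    by (intro meromorphic_intros mero meromorphic_on_compose[OF mero] analytic_intros) auto
  from meromorphic_imp_constant_or_avoid[OF this open_UNIV connected_UNIV, of 0]
  have ev: "\<forall>\<^sub>F y in at z. g (y + \<omega>) = g y" for z
    using freq by (auto simp: eventually_cosparse_open_eq frequently_def)
  have "(\<lambda>y. g (y + \<omega>)) = g \<circ> (+) \<omega>"
    by (auto simp: add.commute)
  hence shift: "filterlim (\<lambda>y. g (y + \<omega>)) F (at z) \<longleftrightarrow> filterlim g F (at (z + \<omega>))" for F z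
    using filterlim_shift_iff[of g \<omega> F "z + \<omega>"] by simp
  have lim_iff: "filterlim g F (at (z + \<omega>)) \<longleftrightarrow> filterlim g F (at z)" for F z
    unfolding shift[symmetric] by (rule filterlim_cong[OF refl refl ev])
  have "g (z + \<omega>) = g z" for z
  proof (cases "is_pole g z")
    case True
    moreover from this have "is_pole g (z + \<omega>)"
      using lim_iff by (simp add: is_pole_def)
    ultimately have "\<not> g \<midarrow>z\<rightarrow> g z" "\<not> g \<midarrow>z + \<omega>\<rightarrow> g (z + \<omega>)"
      unfolding is_pole_def by (meson at_neq_bot not_tendsto_and_filterlim_at_infinity)+
    thus ?thesis using g unfolding nicely_meromorphic_on_def by (metis UNIV_I)
  next
    case False
    hence "\<not> is_pole g (z + \<omega>)"
      using lim_iff by (simp add: is_pole_def)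
    with False g have "g \<midarrow>z\<rightarrow> g z" "g \<midarrow>z + \<omega>\<rightarrow> g (z + \<omega>)"
      unfolding nicely_meromorphic_on_def by blast+
    thus ?thesis unfolding lim_iff by (meson LIM_unique)
  qed
  thus ?thesis by (simp add: period_set_def)
qed

text \<open>Identity theorem for the difference of the two sides, which is meromorphic in w. The
  Moebius relation is written without denominators to admit poles of g. The conclusion concerns
  punctured neighbourhoods, since the value assigned at a pole need not fit.\<close>

lemma parametrised_meromorphic_identity:
  assumes g: "g meromorphic_on UNIV" and e: "e analytic_on S" and h: "h analytic_on S"
    and S: "open S" "connected S" "a \<in> S"
    and ev: "\<forall>\<^sub>F w in nhds a. h w * (A - B * (1 - g (e w))) = D * (1 - g (e w))"
  shows "\<And>x. x \<in> S \<Longrightarrow> \<forall>\<^sub>F w in at x. h w * (A - B * (1 - g (e w))) = D * (1 - g (e w))"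
proof -
  define P where "P = (\<lambda>w. h w * (A - B * (1 - g (e w))) - D * (1 - g (e w)))"
  have "(\<lambda>w. g (e w)) meromorphic_on S"
    by (rule meromorphic_on_compose[OF g e]) auto
  hence "P meromorphic_on S"
    unfolding P_def using analytic_on_imp_meromorphic_on[OF h] by (intro meromorphic_intros)
  from meromorphic_imp_constant_or_avoid[OF this S(1,2), of 0]
  have "(\<forall>x\<in>S. \<forall>\<^sub>F w in at x. P w = 0) \<or> (\<forall>x\<in>S. \<forall>\<^sub>F w in at x. P w \<noteq> 0)"
    using S(1) by (simp add: eventually_cosparse_open_eq)
  moreover have "\<forall>\<^sub>F w in at a. P w = 0"
    using ev by (auto simp: P_def eventually_at_filter elim!: eventually_mono)
  hence "\<not> (\<forall>\<^sub>F w in at a. P w \<noteq> 0)"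
    using eventually_frequently[OF at_neq_bot, of "\<lambda>w. P w = 0" a] by (simp add: frequently_def)
  ultimately show "\<forall>\<^sub>F w in at x. h w * (A - B * (1 - g (e w))) = D * (1 - g (e w))" if "x \<in> S" for x
    using that S(3) by (auto simp: P_def)
qed

text \<open>The relation near 0 and near pi involves the same sin^2 w, and it determines the value
  of g as long as D + B sin^2 w is nonzero. So g agrees at E w / \<mu> and at its translate by E pi
  / \<mu> for all small w \<noteq> 0.\<close>

lemma period_of_parametrised_meromorphic:
  fixes g E :: "complex \<Rightarrow> complex" and B D \<mu> :: complex
  assumes g: "g nicely_meromorphic_on UNIV"
    and S: "open S" "connected S" "0 \<in> S" "of_real pi \<in> S"
    and E: "E holomorphic_on S" "E 0 = 0" "inj_on E S" "\<mu> \<noteq> 0" "D \<noteq> 0"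
    and Epi: "\<And>z. z \<in> S \<Longrightarrow> E (z + of_real pi) = E z + E (of_real pi)"
    and id: "\<And>x. x \<in> S \<Longrightarrow> \<forall>\<^sub>F w in at x. (sin w)\<^sup>2 * (4 - B * (1 - g (E w / \<mu>))) = D * (1 - g (E w / \<mu>))"
  shows "E (of_real pi) / \<mu> \<in> period_set g"
proof -
  define \<omega> where "\<omega> = E (of_real pi) / \<mu>"
  have 1: "\<forall>\<^sub>F w in at 0. (sin w)\<^sup>2 * (4 - B * (1 - g (E w / \<mu>))) = D * (1 - g (E w / \<mu>))"
    using id[OF S(3)] .
  have 2: "\<forall>\<^sub>F w in at 0. (sin (w + of_real pi))\<^sup>2 * (4 - B * (1 - g (E (w + of_real pi) / \<mu>)))
      = D * (1 - g (E (w + of_real pi) / \<mu>))"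
    using id[OF S(4)] by (subst (asm) at_to_0) (simp add: eventually_filtermap)
  have "(\<lambda>w. D + B * (sin w)\<^sup>2) analytic_on {0}"
    by (intro analytic_intros)
  hence "\<forall>\<^sub>F w in nhds 0. D + B * (sin w)\<^sup>2 \<noteq> 0"
    by (rule analytic_at_eventually_nonzero) (use E(5) in simp)
  hence 3: "\<forall>\<^sub>F w in at 0. D + B * (sin w)\<^sup>2 \<noteq> 0"
    by (simp add: eventually_nhds_conv_at)
  have 4: "\<forall>\<^sub>F w in at 0. w \<in> S"
    using S by (intro eventually_at_in_open')
  have ev: "\<forall>\<^sub>F w in at 0. g (E w / \<mu> + \<omega>) = g (E w / \<mu>)"
    using 1 2 3 4
  proof eventually_elim
    case (elim w)
    have "E (w + of_real pi) / \<mu> = E w / \<mu> + \<omega>"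
      using Epi[OF elim(4)] by (simp add: \<omega>_def add_divide_distrib)
    moreover have "(sin (w + of_real pi))\<^sup>2 = (sin w)\<^sup>2"
      by (simp add: sin_add sin_of_real cos_of_real)
    ultimately have "(sin w)\<^sup>2 * (4 - B * (1 - g (E w / \<mu> + \<omega>))) = D * (1 - g (E w / \<mu> + \<omega>))"
      using elim(2) by simp
    hence "(D + B * (sin w)\<^sup>2) * (1 - g (E w / \<mu> + \<omega>)) = 4 * (sin w)\<^sup>2"
      by (simp add: algebra_simps)
    also have "\<dots> = (D + B * (sin w)\<^sup>2) * (1 - g (E w / \<mu>))"
      using elim(1) by (simp add: algebra_simps)
    finally have "(D + B * (sin w)\<^sup>2) * (1 - g (E w / \<mu> + \<omega>)) = (D + B * (sin w)\<^sup>2) * (1 - g (E w / \<mu>))" .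
    thus ?case using elim(3) by simp
  qed
  have "\<exists>\<^sub>F z in at 0. g (z + \<omega>) = g z"
    unfolding frequently_def
  proof
    assume "\<forall>\<^sub>F z in at 0. \<not> g (z + \<omega>) = g z"
    \<comment> \<open>Injectivity of E keeps E w / \<mu> away from 0 for w \<noteq> 0, so agreement
      in w yields agreement at points accumulating at 0.\<close>
    moreover have "filterlim (\<lambda>w. E w / \<mu>) (at 0) (at 0)"
    proof (rule filterlim_atI)
      have "isCont E 0"
        using E(1) S by (metis continuous_on_eq_continuous_at holomorphic_on_imp_continuous_on)
      hence "E \<midarrow>0\<rightarrow> 0" using E(2) by (simp add: isCont_def)
      from tendsto_divide[OF this tendsto_const E(4)] show "((\<lambda>w. E w / \<mu>) \<longlongrightarrow> 0) (at 0)"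
        by simp
      have "\<forall>\<^sub>F w in at 0. w \<in> S - {0}"
        using S by (intro eventually_at_in_open)
      thus "\<forall>\<^sub>F w in at 0. E w / \<mu> \<noteq> 0"
      proof eventually_elim
        case (elim w)
        have "E w \<noteq> E 0" using elim E(3) S(3) by (metis DiffD1 DiffD2 inj_onD singletonI)
        thus ?case using E(2,4) by simp
      qed
    qed
    ultimately have "\<forall>\<^sub>F w in at 0. \<not> g (E w / \<mu> + \<omega>) = g (E w / \<mu>)"
      by (rule eventually_compose_filterlim)
    with ev have "\<forall>\<^sub>F w in at (0::complex). False"
      by eventually_elim simp
    thus False by simp
  qed
  from nicely_meromorphic_frequently_shift_imp_period[OF g this] show ?thesis
    unfolding \<omega>_def .
qed

text \<open>Periodicity makes g continuous at L with value 1, so letting w tend to x in the relation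
  leaves 4 sin^2 x = 0.\<close>

lemma sin_zero_of_period:
  fixes g E :: "complex \<Rightarrow> complex" and B D \<mu> :: complex
  assumes L: "L \<in> period_set g" "isCont g 0" "g 0 = 1"
    and E: "isCont E x" "E x / \<mu> = L" "\<mu> \<noteq> 0"
    and id: "\<forall>\<^sub>F w in at x. (sin w)\<^sup>2 * (4 - B * (1 - g (E w / \<mu>))) = D * (1 - g (E w / \<mu>))"
  shows "sin x = 0"
proof -
  have per: "g (L + z) = g z" for z using L(1) by (simp add: period_set_def add.commute[of L])
  from this[of 0] have gL: "g L = 1" using L(3) by simp
  have "isCont g L"
    using L(2) unfolding isCont_iff[where f = g and x = L] per gL by (simp add: isCont_def L(3))
  hence cont: "isCont (\<lambda>w. g (E w / \<mu>)) x"
    using isCont_o2[of x "\<lambda>w. E w / \<mu>" g] E by simp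
  hence "isCont (\<lambda>w. (sin w)\<^sup>2 * (4 - B * (1 - g (E w / \<mu>))) - D * (1 - g (E w / \<mu>))) x"
    by (intro continuous_intros)
  hence "((\<lambda>w. (sin w)\<^sup>2 * (4 - B * (1 - g (E w / \<mu>))) - D * (1 - g (E w / \<mu>))) \<longlongrightarrow>
     (sin x)\<^sup>2 * (4 - B * (1 - g L)) - D * (1 - g L)) (at x)"
    using E(2) by (simp add: isCont_def)
  moreover have "((\<lambda>w. (sin w)\<^sup>2 * (4 - B * (1 - g (E w / \<mu>))) - D * (1 - g (E w / \<mu>))) \<longlongrightarrow> 0) (at x)"
    using id by (intro tendsto_eventually) (auto elim: eventually_mono)
  ultimately have "(sin x)\<^sup>2 * (4 - B * (1 - g L)) - D * (1 - g L) = 0"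
    by (rule LIM_unique)
  thus ?thesis by (simp add: gL)
qed

section \<open>Trigonometry of the three roots\<close>

text \<open>The numbers \<open>a1\<close>, \<open>a2\<close>, \<open>a3\<close> are the squared
  sines of \<theta>, pi/3 - \<theta>, pi/3 + \<theta>. The first three identities are Vieta's
  relations for the cubic X (3 - 4 X)^2 = sin^2 (3\<theta>), the triple angle formula with X as
  squared sine.\<close>

lemma theta_identities:
  fixes \<theta> :: real
  assumes \<theta>: "0 < \<theta>" "\<theta> < pi / 6"
  defines "a1 \<equiv> (sin \<theta>)\<^sup>2" and "a2 \<equiv> (cos (\<theta> + pi / 6))\<^sup>2" and "a3 \<equiv> (cos (\<theta> - pi / 6))\<^sup>2"
  shows "a1 + a2 + a3 = 3/2" "a1 * a2 + a1 * a3 + a2 * a3 = 9/16"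
    and "(sin (3 * \<theta>))\<^sup>2 = 16 * a1 * a2 * a3"
    and "a2 - a1 = sqrt 3 / 2 * cos (2 * \<theta> + pi / 6)" "a3 - a1 = sqrt 3 / 2 * cos (2 * \<theta> - pi / 6)"
    and "0 < a1" "a1 < a2" "a2 < a3"
proof -
  define S C where "S = sin \<theta>" and "C = cos \<theta>"
  have SC: "C\<^sup>2 = 1 - S\<^sup>2" by (simp add: S_def C_def cos_squared_eq)
  have a1: "a1 = S\<^sup>2" by (simp add: a1_def S_def)
  have a2: "a2 = 3/4 * C\<^sup>2 + S\<^sup>2 / 4 - sqrt 3 / 2 * (S * C)"
    by (simp add: a2_def S_def C_def cos_add cos_30 sin_30 power2_diff power_mult_distrib power_divide algebra_simps)
  have a3: "a3 = 3/4 * C\<^sup>2 + S\<^sup>2 / 4 + sqrt 3 / 2 * (S * C)"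
    by (simp add: a3_def S_def C_def cos_diff cos_30 sin_30 power2_sum power_mult_distrib power_divide algebra_simps)
  have sum: "a2 + a3 = 3/2 - S\<^sup>2"
    by (simp add: a2 a3 SC algebra_simps)
  have prod: "a2 * a3 = (3/4 - S\<^sup>2)\<^sup>2"
  proof -
    have "a2 * a3 = (3/4 * C\<^sup>2 + S\<^sup>2 / 4)\<^sup>2 - (sqrt 3 / 2 * (S * C))\<^sup>2"
      by (simp add: a2 a3 algebra_simps power2_eq_square)
    also have "(sqrt 3 / 2 * (S * C))\<^sup>2 = 3/4 * S\<^sup>2 * C\<^sup>2"
      by (simp add: power_mult_distrib power_divide)
    also have "(3/4 * C\<^sup>2 + S\<^sup>2 / 4)\<^sup>2 - 3/4 * S\<^sup>2 * C\<^sup>2 = (3/4 - S\<^sup>2)\<^sup>2"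
      unfolding SC by (simp add: field_simps power2_eq_square)
    finally show ?thesis .
  qed
  show "a1 + a2 + a3 = 3/2" using sum a1 by simp
  have "a1 * a2 + a1 * a3 + a2 * a3 = a1 * (a2 + a3) + a2 * a3" by (simp add: algebra_simps)
  also have "\<dots> = 9/16"
    unfolding sum prod a1 by (simp add: algebra_simps power2_eq_square)
  finally show "a1 * a2 + a1 * a3 + a2 * a3 = 9/16" .
  have "(sin (3 * \<theta>))\<^sup>2 = (3 * S - 4 * S ^ 3)\<^sup>2" by (simp add: sin_treble_sin S_def)
  also have "\<dots> = 16 * a1 * (a2 * a3)"
    unfolding prod a1 by (simp add: algebra_simps power2_eq_square power3_eq_cube)
  finally show "(sin (3 * \<theta>))\<^sup>2 = 16 * a1 * a2 * a3" by simp
  have cs: "sin (2 * \<theta>) = 2 * (S * C)" "cos (2 * \<theta>) = C\<^sup>2 - S\<^sup>2"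
    by (simp_all add: S_def C_def sin_double cos_double)
  have s3: "sqrt 3 * (sqrt 3 * x) = 3 * x" for x :: real
    by (simp flip: mult.assoc)
  show 21: "a2 - a1 = sqrt 3 / 2 * cos (2 * \<theta> + pi / 6)"
    unfolding cos_add cs cos_30 sin_30 a1 a2 by (simp add: algebra_simps s3)
  show 31: "a3 - a1 = sqrt 3 / 2 * cos (2 * \<theta> - pi / 6)"
    unfolding cos_diff cs cos_30 sin_30 a1 a3 by (simp add: algebra_simps s3)
  have "S > 0" "C > 0" using \<theta> by (auto simp: S_def C_def intro!: sin_gt_zero cos_gt_zero)
  thus "0 < a1" "a2 < a3" by (auto simp: a1 a2 a3)
  have "cos (2 * \<theta> + pi / 6) > 0" using \<theta> by (intro cos_gt_zero) auto
  hence "sqrt 3 / 2 * cos (2 * \<theta> + pi / 6) > 0" by simp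
  thus "a1 < a2" using 21 by linarith
qed

theorem theorem9:
  fixes \<kappa> lam \<theta> M K K' k' :: real and dn3 :: "complex \<Rightarrow> complex"
  assumes "0 < \<kappa>" "\<kappa> < 1" "0 < lam" "lam < 1" "\<kappa>\<^sup>2 + lam\<^sup>2 = 1"
    and "0 < \<theta>" "\<theta> < pi / 6" "lam = cos (3 * \<theta>)"
    and "0 < M"
    and "M\<^sup>2 = 2 * sqrt 3 * (cos (\<theta> + pi / 6))\<^sup>2 * cos (2 * \<theta> - pi / 6)"
    and "is_dn3 \<kappa> dn3"
    and "0 < K" "0 < K'" "period_set dn3 = rect_lattice K K'"
    and "k'\<^sup>2 = ((cos (\<theta> - pi / 6))\<^sup>2 * cos (2 * \<theta> + pi / 6)) /
                ((cos (\<theta> + pi / 6))\<^sup>2 * cos (2 * \<theta> - pi / 6))"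
  shows "2 * K' = (3 * pi) / (2 * M) * hyp2F1 (1/2) (1/2) 1 (k'\<^sup>2)"
proof -

  \<comment> \<open>Parameters of the elliptic integral\<close>
  define a1 a2 a3 where "a1 = (sin \<theta>)\<^sup>2" and "a2 = (cos (\<theta> + pi / 6))\<^sup>2" and "a3 = (cos (\<theta> - pi / 6))\<^sup>2"
  note th = theta_identities[OF assms(6,7), folded a1_def a2_def a3_def]
  define p q r where "p = 1 / a1" and "q = 1 / a2" and "r = 1 / a3"
  have pos: "0 < a1" "0 < a2" "0 < a3" "a1 < a3" using th by auto
  have \<kappa>2: "\<kappa>\<^sup>2 = 16 * a1 * a2 * a3"
    using assms(5,8) th(3) by (simp add: cos_squared_eq)
  define m where "m = k'\<^sup>2"
  \<comment> \<open>After cancelling sqrt 3 / 2 this is (p - q) / (p - r), the parameter required by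
    Legendre's substitution.\<close>
  have m_eq: "m = a3 * (a2 - a1) / (a2 * (a3 - a1))"
  proof -
    have "a3 * (a2 - a1) / (a2 * (a3 - a1)) =
      ((sqrt 3 / 2) * (a3 * cos (2 * \<theta> + pi / 6))) / ((sqrt 3 / 2) * (a2 * cos (2 * \<theta> - pi / 6)))"
      unfolding th(4,5) by (simp only: mult_ac)
    also have "\<dots> = (a3 * cos (2 * \<theta> + pi / 6)) / (a2 * cos (2 * \<theta> - pi / 6))"
      by (rule mult_divide_mult_cancel_left) simp
    finally show ?thesis
      unfolding m_def assms(15) a2_def[symmetric] a3_def[symmetric] by simp
  qed
  have m: "0 < m" "m < 1"
  proof -
    show "0 < m" unfolding m_eq using th pos by auto
    have "a1 * a2 < a1 * a3" using th by simp
    hence "a3 * (a2 - a1) < a2 * (a3 - a1)" by (simp add: algebra_simps)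
    moreover have "0 < a2 * (a3 - a1)" using pos by simp
    ultimately show "m < 1" unfolding m_eq by (simp only: divide_less_eq_1_pos)
  qed
  have mpqr: "m * (p - r) = p - q"
    unfolding m_eq p_def q_def r_def using pos th(7) by (simp add: divide_simps)
  \<comment> \<open>The right side is minus the square of the multiplier \<mu> found below, so this
    identity brings M into the proof.\<close>
  have M2: "4 / 9 * M\<^sup>2 = (p - r) * (\<kappa>\<^sup>2 / 9)"
  proof -
    have "M\<^sup>2 = 4 * a2 * (a3 - a1)"
      unfolding th(5) assms(10) a2_def[symmetric] by simp
    moreover have "(p - r) * (\<kappa>\<^sup>2 / 9) = 16 / 9 * a2 * (a3 - a1)"
      unfolding \<kappa>2 p_def r_def using pos by (simp add: field_simps)
    ultimately show ?thesis by simp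
  qed
  have pr: "p \<noteq> r" using pos by (auto simp: p_def r_def)

  \<comment> \<open>The differential equation near 0\<close>
  from assms(11) obtain \<phi> where nm: "dn3 nicely_meromorphic_on UNIV"
    and \<phi>: "local_inverse_at_0 (dn3_int \<kappa>) \<phi>" "\<forall>\<^sub>F z in nhds 0. dn3 z = deriv \<phi> z"
    by (auto simp: is_dn3_def elliptic_function_def)
  from deriv_local_inverse_dn3_int[OF \<phi>(1)] obtain s where
    s: "s analytic_on {0}" "s 0 = 0" and "\<forall>\<^sub>F z in nhds 0. deriv \<phi> z = 1 - 4 * (s z)\<^sup>2"
    and ode: "\<forall>\<^sub>F z in nhds 0. 9 * (deriv s z)\<^sup>2 = (of_real \<kappa>)\<^sup>2 - (3 * s z - 4 * s z ^ 3)\<^sup>2"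
    by blast
  have dn3_s: "\<forall>\<^sub>F z in nhds 0. dn3 z = 1 - 4 * (s z)\<^sup>2"
    using \<phi>(2) \<open>\<forall>\<^sub>F z in nhds 0. deriv \<phi> z = _ z\<close> by eventually_elim simp
  have dn3_0: "dn3 0 = 1"
    using eventually_nhds_x_imp_x[OF dn3_s] s(2) by simp
  have "isCont (\<lambda>z. 1 - 4 * (s z)\<^sup>2) 0"
    using analytic_at_imp_isCont[OF s(1)] by (intro continuous_intros)
  hence cont_0: "isCont dn3 0"
    using isCont_cong[OF dn3_s] by simp
  have ode': "\<forall>\<^sub>F z in nhds 0. (deriv s z)\<^sup>2 =
    of_real (\<kappa>\<^sup>2 / 9) * (1 - of_real p * (s z)\<^sup>2) * (1 - of_real q * (s z)\<^sup>2) * (1 - of_real r * (s z)\<^sup>2)"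
    using ode
  proof eventually_elim
    case (elim z)
    define X where "X = (s z)\<^sup>2"
    \<comment> \<open>As a polynomial in X the right side is factored by Vieta's relations for
      \<open>a1\<close>, \<open>a2\<close>, \<open>a3\<close>.\<close>
    have "9 * (deriv s z)\<^sup>2 = of_real (16 * a1 * a2 * a3) - 9 * X + 24 * X\<^sup>2 - 16 * X ^ 3"
      unfolding elim X_def \<kappa>2[symmetric] by (simp add: algebra_simps power2_eq_square power3_eq_cube)
    also have "\<dots> = 16 * (of_real (a1 * a2 * a3) - of_real (a1 * a2 + a1 * a3 + a2 * a3) * X
                         + of_real (a1 + a2 + a3) * X\<^sup>2 - X ^ 3)"
      unfolding th(1,2) by simp
    also have "\<dots> = 16 * (of_real a1 - X) * (of_real a2 - X) * (of_real a3 - X)"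
      by (simp add: algebra_simps power2_eq_square power3_eq_cube)
    also have "\<dots> = of_real (\<kappa>\<^sup>2) * (1 - of_real p * X) * (1 - of_real q * X) * (1 - of_real r * X)"
      unfolding \<kappa>2 p_def q_def r_def using pos by (simp add: field_simps)
    finally show ?case by (simp add: X_def mult.commute[of _ 9])
  qed

  \<comment> \<open>The strip, the elliptic integral and its multiplier\<close>
  define S where "S = {z. \<bar>Im z\<bar> < (1 - m) / 2}"
  have opS: "open S" and "convex S"
    unfolding S_def by (rule open_strip convex_strip)+
  hence conS: "connected S" by (simp add: convex_connected)
  have realS: "of_real x \<in> S" for x using m by (simp add: S_def)
  have S0: "0 \<in> S" using realS[of 0] by simp
  from elliptic_integral_exists[OF m] obtain E where
    E: "\<And>z. z \<in> S \<Longrightarrow> (E has_field_derivative 1 / csqrt (1 - of_real m * (sin z)\<^sup>2)) (at z)"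
    "E 0 = 0" "inj_on E S" "\<And>z. z \<in> S \<Longrightarrow> E (z + of_real pi) = E z + E (of_real pi)"
    "\<And>x. E (of_real x) = of_real (Re (E (of_real x)))"
    "\<And>x. ((\<lambda>x. Re (E (of_real x))) has_real_derivative 1 / sqrt (1 - m * (sin x)\<^sup>2)) (at x)"
    unfolding S_def mem_Collect_eq by blast
  define e where "e = (\<lambda>x. Re (E (of_real x)))"
  have E_real: "E (of_real x) = of_real (e x)" for x using E(5)[of x] by (simp add: e_def)
  have e_deriv: "(e has_real_derivative 1 / sqrt (1 - m * (sin x)\<^sup>2)) (at x)" for x
    using E(6)[of x] by (simp add: e_def)
  have e0: "e 0 = 0" using E(2) by (simp add: e_def)
  have E_holo: "E holomorphic_on S" using E(1) opS by (auto simp: holomorphic_on_open)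

  obtain \<mu> where \<mu>2: "\<mu>\<^sup>2 = of_real (r - p) * of_real (\<kappa>\<^sup>2 / 9)"
    and \<mu>: "\<forall>\<^sub>F w in nhds 0. (sin w)\<^sup>2 * (1 - of_real p * (s (E w / \<mu>))\<^sup>2) = of_real (r - p) * (s (E w / \<mu>))\<^sup>2"
  proof (rule elliptic_integral_linearises[OF s ode' _ _ _ opS S0 E(2) E(3), of "of_real m"])
    show "of_real m * (of_real p - of_real r) = of_real p - (of_real q :: complex)"
      by (simp flip: of_real_diff of_real_mult add: mpqr)
    show "of_real (\<kappa>\<^sup>2 / 9) \<noteq> (0 :: complex)" using assms(1) by simp
    show "of_real p \<noteq> (of_real r :: complex)" using pr by simp
  qed (use E(1) that in auto)
  \<comment> \<open>Since r < p, the multiplier is purely imaginary: real values of E correspond to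
    imaginary arguments of \<open>dn3\<close>. Its sign \<sigma> stays undetermined.\<close>
  have "\<mu>\<^sup>2 = - (of_real (2 * M / 3))\<^sup>2"
  proof -
    have "(r - p) * (\<kappa>\<^sup>2 / 9) = - (2 * M / 3)\<^sup>2"
      using M2 by (simp add: power_divide algebra_simps)
    thus ?thesis unfolding \<mu>2 by (metis of_real_minus of_real_mult of_real_power)
  qed
  hence "\<mu>\<^sup>2 = (\<i> * of_real (2 * M / 3))\<^sup>2"
    by (simp only: power_mult_distrib power2_i mult_minus1)
  hence "\<mu> = of_int 1 * (\<i> * of_real (2 * M / 3)) \<or> \<mu> = of_int (- 1) * (\<i> * of_real (2 * M / 3))"
    unfolding power2_eq_iff by simp
  then obtain \<sigma> :: int where \<sigma>: "\<sigma> = 1 \<or> \<sigma> = -1" and \<mu>_eq: "\<mu> = of_int \<sigma> * (\<i> * of_real (2 * M / 3))"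
    by blast
  have \<mu>_nz: "\<mu> \<noteq> 0" using \<mu>_eq \<sigma> assms(9) by auto

  have E_an: "(\<lambda>w. E w / \<mu>) analytic_on S"
    using E_holo opS \<mu>_nz by (intro analytic_intros) (auto simp: analytic_on_open)
  have id: "\<forall>\<^sub>F w in at x. (sin w)\<^sup>2 * (4 - of_real p * (1 - dn3 (E w / \<mu>))) = of_real (r - p) * (1 - dn3 (E w / \<mu>))"
    if "x \<in> S" for x
  proof (rule parametrised_meromorphic_identity[OF _ E_an _ opS conS S0 _ that])
    show "dn3 meromorphic_on UNIV" using nm by (simp add: nicely_meromorphic_on_def)
    show "(\<lambda>w. (sin w)\<^sup>2) analytic_on S" by (intro analytic_intros)
    have "(\<lambda>w. E w / \<mu>) analytic_on {0}" using analytic_on_subset[OF E_an] S0 by simp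
    moreover have "\<forall>\<^sub>F z in nhds (E 0 / \<mu>). dn3 z = 1 - 4 * (s z)\<^sup>2"
      using dn3_s by (simp add: E(2))
    ultimately have "\<forall>\<^sub>F w in nhds 0. dn3 (E w / \<mu>) = 1 - 4 * (s (E w / \<mu>))\<^sup>2"
      by (intro eventually_nhds_compose_analytic[where f = "\<lambda>w. E w / \<mu>"])
    with \<mu> show "\<forall>\<^sub>F w in nhds 0. (sin w)\<^sup>2 * (4 - of_real p * (1 - dn3 (E w / \<mu>))) = of_real (r - p) * (1 - dn3 (E w / \<mu>))"
    proof eventually_elim
      case (elim w)
      have "(sin w)\<^sup>2 * (4 - of_real p * (1 - dn3 (E w / \<mu>))) = 4 * ((sin w)\<^sup>2 * (1 - of_real p * (s (E w / \<mu>))\<^sup>2))"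
        by (simp add: elim(2) algebra_simps)
      thus ?case unfolding elim(1) by (simp add: elim(2))
    qed
  qed

  \<comment> \<open>Comparison with the lattice\<close>
  have "E (of_real pi) / \<mu> \<in> period_set dn3"
    by (rule period_of_parametrised_meromorphic[OF nm opS conS S0 realS E_holo E(2,3) \<mu>_nz _ E(4) id])
      (use pr in auto)
  then obtain j n :: int where "E (of_real pi) / \<mu> = 2 * of_int j * of_real K + 2 * of_int n * (\<i> * of_real K')"
    unfolding assms(14) rect_lattice_def by blast
  hence "complex_of_real (e pi) = \<mu> * (2 * of_int j * of_real K + 2 * of_int n * (\<i> * of_real K'))"
    using \<mu>_nz by (simp add: E_real field_simps)
  \<comment> \<open>As \<mu> is imaginary, the real part removes the term with K; hence
    \<open>e pi\<close> is an integer multiple of 4 M K' / 3.\<close>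
  hence "Re (complex_of_real (e pi)) = Re (\<mu> * (2 * of_int j * of_real K + 2 * of_int n * (\<i> * of_real K')))"
    by (rule arg_cong)
  hence e_pi: "e pi = of_int (- \<sigma> * n) * (2 * K' * (2 * M / 3))"
    unfolding \<mu>_eq by simp

  \<comment> \<open>The sign makes \<mu> L positive whichever value \<sigma> has.\<close>
  define L where "L = - of_int \<sigma> * (2 * \<i> * of_real K')"
  have L: "L \<in> period_set dn3"
    unfolding assms(14) rect_lattice_def mem_Collect_eq L_def
    by (rule exI[of _ 0], rule exI[of _ "-\<sigma>"]) simp
  have \<mu>L: "\<mu> * L = of_real (2 * K' * (2 * M / 3))"
    unfolding L_def \<mu>_eq using \<sigma> by auto
  define y where "y = 2 * K' * (2 * M / 3)"
  have "y > 0" using assms(9,13) by (simp add: y_def)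
  \<comment> \<open>The slope of e is at least 1 and e vanishes at 0, so e y \<ge> y and the
    intermediate value theorem applies on the interval from 0 to y.\<close>
  obtain x where x: "0 \<le> x" "e x = y"
  proof -
    have "e 0 - 0 \<le> e y - y"
    proof (rule DERIV_nonneg_imp_nondecreasing[where f = "\<lambda>x. e x - x"])
      fix x
      have "m * (sin x)\<^sup>2 \<le> m * 1"
        using m by (intro mult_left_mono) (auto simp: abs_square_le_1)
      hence "m * (sin x)\<^sup>2 < 1" using m by linarith
      moreover have "0 \<le> m * (sin x)\<^sup>2" using m by simp
      ultimately have "1 / sqrt (1 - m * (sin x)\<^sup>2) \<ge> 1"
        using m by (simp add: le_divide_eq)
      thus "\<exists>D. ((\<lambda>x. e x - x) has_real_derivative D) (at x) \<and> 0 \<le> D"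
        by (intro exI[of _ "1 / sqrt (1 - m * (sin x)\<^sup>2) - 1"] conjI DERIV_diff e_deriv DERIV_ident) auto
    qed (use \<open>y > 0\<close> in simp)
    hence "e 0 \<le> y" "y \<le> e y" using e0 \<open>y > 0\<close> by auto
    moreover have "\<forall>x. 0 \<le> x \<and> x \<le> y \<longrightarrow> isCont e x"
      using e_deriv DERIV_isCont by blast
    ultimately show ?thesis using IVT[of e 0 y y] \<open>y > 0\<close> that by auto
  qed
  have "x > 0" using x e0 \<open>y > 0\<close> by (cases "x = 0") auto
  have "sin (complex_of_real x) = 0"
  proof (rule sin_zero_of_period[OF L cont_0 dn3_0 _ _ \<mu>_nz id[OF realS]])
    show "isCont E (of_real x)" using E(1)[OF realS] by (rule DERIV_isCont)
    show "E (of_real x) / \<mu> = L"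
      using \<mu>L \<mu>_nz by (simp add: E_real x(2) y_def field_simps)
  qed
  hence "sin x = 0" by (simp add: sin_of_real)
  then obtain i :: int where "x = of_int i * pi" by (auto simp: sin_zero_iff_int2)
  moreover from this \<open>x > 0\<close> have "i > 0" by (simp add: zero_less_mult_iff)
  ultimately obtain N :: nat where N: "x = real N * pi"
    by (metis of_int_of_nat_eq zero_less_imp_eq_int)
  have "e (real n * pi) = real n * e pi" for n :: nat
  proof (induction n)
    case (Suc n)
    have "E (of_real (real n * pi) + of_real pi) = E (of_real (real n * pi)) + E (of_real pi)"
      by (rule E(4)[OF realS])
    hence "complex_of_real (e (real n * pi + pi)) = of_real (e (real n * pi) + e pi)"
      by (simp only: E_real of_real_add flip: of_real_add)
    hence "e (real n * pi + pi) = e (real n * pi) + e pi"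
      by (simp only: of_real_eq_iff)
    with Suc show ?case by (simp add: algebra_simps)
  qed (simp add: e0)
  from this[of N] have y_N: "y = real N * e pi" using x(2) N by simp
  \<comment> \<open>Each of y and \<open>e pi\<close> is an integer multiple of the other, so the
    positive integer N divides 1.\<close>
  have "y = real N * (of_int (- \<sigma> * n) * y)"
    using y_N unfolding e_pi y_def .
  hence "y = of_int (int N * (- \<sigma> * n)) * y"
    unfolding of_int_mult[of "int N"] of_int_of_nat_eq mult.assoc[of "real N"] .
  hence "of_int (int N * (- \<sigma> * n)) = (1 :: real)" using \<open>y > 0\<close>
    by (metis less_irrefl mult_cancel_right1)
  hence "int N * (- \<sigma> * n) = 1" by (simp only: of_int_eq_1_iff)
  hence "N = 1" unfolding zmult_eq_1_iff by auto
  with y_N have "y = e pi" by simp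
  also have "e pi = pi * hyp2F1 (1/2) (1/2) 1 m"
  proof -
    have "((\<lambda>x. 1 / sqrt (1 - m * (sin x)\<^sup>2)) has_integral e pi - e 0) {0..pi}"
      using e_deriv by (intro fundamental_theorem_of_calculus)
        (auto simp: has_real_derivative_iff_has_vector_derivative[symmetric] intro: has_field_derivative_at_within)
    from has_integral_unique[OF this complete_elliptic_has_integral] m e0 show ?thesis by simp
  qed
  finally show ?thesis
    using assms(9) by (simp add: y_def m_def field_simps)
qed

end
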